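(* Let $(\Omega,\mathcal{F},(\mathcal{F}_t)_{t\ge0},P)$ be a filtered probability space with right-continuous filtration and let $(\mathcal{G}_t)_{t\ge0}$ be a filtration with $\mathcal{F}_t\subseteq\mathcal{G}_t\subseteq\mathcal{F}$ for all $t\ge0$, such that $\mathcal{G}_t$ is countably generated for every $t\ge0$. Assume that there exists a universal supermartingale density for $(\mathcal{G}_t)$. Then the generalized Jacod condition is satisfied: for all $t,s\ge0$, almost surely $$P_{t+s}(\omega,\cdot)|_{\mathcal{G}_t}\ll P_t(\omega,\cdot)|_{\mathcal{G}_t}.$$
   Context: Filtrations are not assumed complete; (super)martingales are understood to be a.s. càdlàg. For each $t\ge0$, $P_t(\omega,\cdot)$ denotes a regular conditional probability of $P$ given $\mathcal{F}_t$ on $\mathcal{G}_t$, i.e. $P_t(\omega,B)=P(B\mid\mathcal{F}_t)(\omega)$ for $B\in\mathcal{G}_t$; these regular conditional probabilities are taken to exist. A universal supermartingale density for $(\mathcal{G}_t)$ is a $(\mathcal{G}_t)$-adapted, a.s. càdlàg process $Z$ with $P(Z_t>0)=1$ for all $t\ge0$ such that $ZM$ is a $(\mathcal{G}_t)$-supermartingale for every nonnegative $(\mathcal{F}_t)$-supermartingale $M$. *)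

theory Defs
  imports "HOL-Probability.Probability"
begin

(* Time is [0,\<infinity>), rendered as the nonnegative reals: the library locale "filtration" would also
   constrain the sigma-algebras at negative indices, so every condition is guarded by 0 \<le> t instead.
   The measures F t serve only as sigma-algebras; the probability is always that of M. *)
definition filtration_of :: "'a measure \<Rightarrow> (real \<Rightarrow> 'a measure) \<Rightarrow> bool" where
  "filtration_of M F \<longleftrightarrow>
     (\<forall>t\<ge>0. subalgebra M (F t)) \<and>
     (\<forall>s t. 0 \<le> s \<longrightarrow> s \<le> t \<longrightarrow> subalgebra (F t) (F s))"

definition right_continuous_filtration :: "(real \<Rightarrow> 'a measure) \<Rightarrow> bool" where
  "right_continuous_filtration F \<longleftrightarrow> (\<forall>t\<ge>0. sets (F t) = (\<Inter>u\<in>{t<..}. sets (F u)))"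

definition countably_generated :: "'a measure \<Rightarrow> bool" where
  "countably_generated N \<longleftrightarrow>
     (\<exists>C. countable C \<and> C \<subseteq> Pow (space N) \<and> sets N = sigma_sets (space N) C)"

definition adapted_to :: "(real \<Rightarrow> 'a measure) \<Rightarrow> (real \<Rightarrow> 'a \<Rightarrow> real) \<Rightarrow> bool" where
  "adapted_to F X \<longleftrightarrow> (\<forall>t\<ge>0. X t \<in> borel_measurable (F t))"

definition cadlag :: "(real \<Rightarrow> real) \<Rightarrow> bool" where
  "cadlag f \<longleftrightarrow>
     (\<forall>t\<ge>0. (f \<longlongrightarrow> f t) (at_right t)) \<and>
     (\<forall>t>0. \<exists>l. (f \<longlongrightarrow> l) (at_left t))"

definition as_cadlag :: "'a measure \<Rightarrow> (real \<Rightarrow> 'a \<Rightarrow> real) \<Rightarrow> bool" where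
  "as_cadlag M X \<longleftrightarrow> (AE \<omega> in M. cadlag (\<lambda>t. X t \<omega>))"

definition supermartingale ::
  "'a measure \<Rightarrow> (real \<Rightarrow> 'a measure) \<Rightarrow> (real \<Rightarrow> 'a \<Rightarrow> real) \<Rightarrow> bool" where
  "supermartingale M F X \<longleftrightarrow>
     adapted_to F X \<and> as_cadlag M X \<and>
     (\<forall>t\<ge>0. integrable M (X t)) \<and>
     (\<forall>s t. 0 \<le> s \<longrightarrow> s \<le> t \<longrightarrow> (AE \<omega> in M. real_cond_exp M (F s) (X t) \<omega> \<le> X s \<omega>))"

definition universal_supermartingale_density ::
  "'a measure \<Rightarrow> (real \<Rightarrow> 'a measure) \<Rightarrow> (real \<Rightarrow> 'a measure) \<Rightarrow> (real \<Rightarrow> 'a \<Rightarrow> real) \<Rightarrow> bool" where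
  "universal_supermartingale_density M F G Z \<longleftrightarrow>
     adapted_to G Z \<and> as_cadlag M Z \<and>
     (\<forall>t\<ge>0. measure M {\<omega> \<in> space M. Z t \<omega> > 0} = 1) \<and>
     (\<forall>X. supermartingale M F X \<longrightarrow> (\<forall>t\<ge>0. \<forall>\<omega>\<in>space M. 0 \<le> X t \<omega>) \<longrightarrow>
        supermartingale M G (\<lambda>t \<omega>. Z t \<omega> * X t \<omega>))"

(* A version of the conditional probability given the sub-sigma-algebra A, on the events of B,
   that is a Markov kernel from A to B. *)
definition regular_cond_prob ::
  "'a measure \<Rightarrow> 'a measure \<Rightarrow> 'a measure \<Rightarrow> ('a \<Rightarrow> 'a measure) \<Rightarrow> bool" where
  "regular_cond_prob M A B K \<longleftrightarrow>
     K \<in> measurable A (prob_algebra B) \<and>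
     (\<forall>E\<in>sets B. AE \<omega> in M. measure (K \<omega>) E = real_cond_exp M A (indicator E) \<omega>)"

(* absolutely_continuous \<mu> \<nu> means \<nu> << \<mu>.  K (t + s) \<omega> lives on G (t + s) and is
   restricted to G t, on which K t \<omega> already lives. *)
definition generalized_jacod ::
  "'a measure \<Rightarrow> (real \<Rightarrow> 'a measure) \<Rightarrow> (real \<Rightarrow> 'a \<Rightarrow> 'a measure) \<Rightarrow> bool" where
  "generalized_jacod M G K \<longleftrightarrow>
     (\<forall>t\<ge>0. \<forall>s\<ge>0. AE \<omega> in M.
        absolutely_continuous (K t \<omega>) (restr_to_subalg (K (t + s) \<omega>) (G t)))"

end

theory Submission
  imports Defs
begin

text \<open>
  Put $u = t + s$. Applied to a cadlag version of the bounded martingale $E[1_B \mid F_r]$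
  with $B \in F_u$, the supermartingale property of the density gives
  $E[Z_u 1_B 1_A] \le E[Z_t E[1_B \mid F_t] 1_A]$ for all $A \in G_t$. Disintegrating along the kernels,
  this says that $\int_A Z_u \, dP_u(\omega,\cdot) \le \int_A Z_t \, dP_t(\omega,\cdot)$ for almost every
  $\omega$, for each fixed $A \in G_t$. As $G_t$ is generated by a countable algebra, almost surely the
  inequality holds for all $A \in G_t$ at once. If $P_t(\omega,A) = 0$, the right-hand side vanishes, and since
  $Z_u > 0$ holds $P_u(\omega,\cdot)$-almost surely, so does $P_u(\omega,A)$.

  The cadlag version is the right limit along the dyadics. Instead of upcrossings, its existence uses that a
  martingale with values in $[0,1]$ makes at most $1/\varepsilon^2$ oscillations of size $2\varepsilon$
  on average, uniformly over all finite sets of times.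
\<close>

section \<open>Oscillations along the dyadics and right limits\<close>

text \<open>The density may be tested only against processes adapted to the uncompleted filtration,
  almost surely cadlag and nonnegative at every outcome. The values P(B | F_r) at uncountably many
  times r have to become such a process without cutting out an exceptional null set, which need not
  belong to F_r. Therefore only total operations are used: clipping to [0,1] and \<open>lim\<close>
  along one explicit sequence of dyadics strictly above r. Right continuity of the filtration then
  returns the limit to F_r.

  The bound 1/e^2 arises because the square of a value in [0,1] caps the mean total of squared
  anchor jumps by 1, while every oscillation of size 2e costs at least e^2. No pair of levels
  enters, and the bound is independent of the time horizon, so a single null set serves left and
  right limits at all times.\<close>

text \<open>The anchor follows the sequence only when that has moved away from it by at least e. For a
  martingale the sum in the identity below has mean zero, which bounds the mean of the squared jumps.\<close>

primrec anchor :: "real \<Rightarrow> (nat \<Rightarrow> real) \<Rightarrow> nat \<Rightarrow> real" where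
  "anchor e x 0 = x 0"
| "anchor e x (Suc k) = (if e \<le> \<bar>x (Suc k) - anchor e x k\<bar> then x (Suc k) else anchor e x k)"

definition anchor_jumps :: "real \<Rightarrow> (nat \<Rightarrow> real) \<Rightarrow> nat \<Rightarrow> real" where
  "anchor_jumps e x n = (\<Sum>k<n. (anchor e x (Suc k) - anchor e x k)\<^sup>2)"

lemma anchor_jumps_nonneg: "0 \<le> anchor_jumps e x n"
  by (simp add: anchor_jumps_def sum_nonneg)

text \<open>At each step either the anchor jumps, and the gap to the sequence closes, or it stays,
  and the gap becomes \<open>x (Suc n) - anchor e x n\<close>. In both cases squared jump plus
  squared new gap is the square of this number. The last sum is a discrete stochastic integral: its
  weights look only at terms up to index k.\<close>

lemma anchor_jumps_identity:
  "anchor_jumps e x n + (x n - anchor e x n)\<^sup>2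
     = (x n)\<^sup>2 - (x 0)\<^sup>2 - 2 * (\<Sum>k<n. anchor e x k * (x (Suc k) - x k))"
proof (induction n)
  case (Suc n)
  have "anchor_jumps e x (Suc n) + (x (Suc n) - anchor e x (Suc n))\<^sup>2
      = anchor_jumps e x n + (x (Suc n) - anchor e x n)\<^sup>2"
    by (auto simp: anchor_jumps_def)
  with Suc show ?case
    by (simp add: power2_eq_square algebra_simps)
qed (simp add: anchor_jumps_def)

lemma anchor_range:
  assumes "\<And>k. x k \<in> S"
  shows "anchor e x n \<in> S"
  using assms by (induction n) auto

lemma anchor_close:
  assumes "e > 0"
  shows "\<bar>x k - anchor e x k\<bar> < e"
  using assms by (cases k) auto

text \<open>The sequence is within e of its anchor at both i and j, so an anchor that rests in
  between would keep the two values less than 2e apart. Any jump of the anchor has size at least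
  e.\<close>

lemma anchor_jump_between:
  assumes "e > 0" "i < j" "2 * e \<le> \<bar>x i - x j\<bar>"
  shows "e\<^sup>2 \<le> (\<Sum>k\<in>{i..<j}. (anchor e x (Suc k) - anchor e x k)\<^sup>2)"
proof -
  have "\<exists>k\<in>{i..<j}. anchor e x (Suc k) \<noteq> anchor e x k"
  proof (rule ccontr)
    assume "\<not> ?thesis"
    then have step: "anchor e x (Suc k) = anchor e x k" if "i \<le> k" "k < j" for k
      using that by auto
    have "anchor e x j = anchor e x i"
      using less_imp_le[OF \<open>i < j\<close>]
      by (induction rule: dec_induct) (simp_all only: step)
    with anchor_close[OF \<open>e > 0\<close>, of x i] anchor_close[OF \<open>e > 0\<close>, of x j] assms(3)
    show False by linarith
  qed
  then obtain k where k: "k \<in> {i..<j}" "anchor e x (Suc k) \<noteq> anchor e x k" by blast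
  then have "e \<le> \<bar>anchor e x (Suc k) - anchor e x k\<bar>"
    by (auto split: if_splits)
  then have "e\<^sup>2 \<le> (anchor e x (Suc k) - anchor e x k)\<^sup>2"
    using \<open>e > 0\<close> abs_le_square_iff by fastforce
  also have "\<dots> \<le> (\<Sum>k\<in>{i..<j}. (anchor e x (Suc k) - anchor e x k)\<^sup>2)"
    by (rule member_le_sum) (use k in auto)
  finally show ?thesis .
qed

lemma anchor_jumps_ge_oscillations:
  fixes p q :: "nat \<Rightarrow> nat"
  assumes "e > 0" "disjoint_family_on (\<lambda>i. {p i..<q i}) {..<m}"
    and "\<And>i. i < m \<Longrightarrow> p i < q i \<and> q i \<le> n \<and> 2 * e \<le> \<bar>x (p i) - x (q i)\<bar>"
  shows "real m * e\<^sup>2 \<le> anchor_jumps e x n"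
proof -
  let ?d = "\<lambda>k. (anchor e x (Suc k) - anchor e x k)\<^sup>2"
  have "real m * e\<^sup>2 = (\<Sum>i<m. e\<^sup>2)" by simp
  also have "\<dots> \<le> (\<Sum>i<m. \<Sum>k\<in>{p i..<q i}. ?d k)"
    by (rule sum_mono, rule anchor_jump_between) (use assms in auto)
  also have "\<dots> = (\<Sum>k\<in>(\<Union>i<m. {p i..<q i}). ?d k)"
    by (rule sum.UNION_disjoint[symmetric])
       (use assms(2) in \<open>auto simp: disjoint_family_on_def\<close>)
  also have "\<dots> \<le> (\<Sum>k<n. ?d k)"
    by (rule sum_mono2) (use assms(3) in force)+
  finally show ?thesis unfolding anchor_jumps_def .
qed

text \<open>The intervals may come in any order and may run off to infinity. Half-open intervals let
  neighbours share an endpoint and still charge disjoint sets of grid steps.\<close>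

definition oscillates :: "real \<Rightarrow> (real \<Rightarrow> real) \<Rightarrow> bool" where
  "oscillates e x \<longleftrightarrow> (\<exists>p q :: nat \<Rightarrow> real. disjoint_family (\<lambda>i. {p i..<q i}) \<and>
     (\<forall>i. p i \<in> dyadics \<and> q i \<in> dyadics \<and> p i < q i \<and> e \<le> \<bar>x (p i) - x (q i)\<bar>))"

text \<open>With mesh 1/2^n and indices up to 4^n the grid reaches time 2^n: it refines and
  lengthens at once, so that it finally catches every dyadic.\<close>

lemma dyadic_grid_index:
  assumes "d \<in> (dyadics :: real set)"
  shows "\<forall>\<^sub>F n in sequentially. \<exists>k\<le>4 ^ n. d = real k / 2 ^ n"
proof -
  obtain a m where d: "d = real m / 2 ^ a" using assms by (auto simp: dyadics_def)
  have "\<exists>k\<le>4 ^ n. d = real k / 2 ^ n" if n: "n \<ge> max a m" for n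
  proof (intro exI conjI)
    have "m * 2 ^ (n - a) \<le> 2 ^ n * 2 ^ n"
      proof (intro mult_mono power_increasing)
      show "m \<le> 2 ^ n" using n less_exp[of n] by linarith
    qed (use n in auto)
    also have "\<dots> = (4::nat) ^ n" by (simp flip: power_mult_distrib)
    finally show "m * 2 ^ (n - a) \<le> 4 ^ n" .
    have "(2::real) ^ n = 2 ^ (n - a) * 2 ^ a" using n by (simp flip: power_add)
    then show "d = real (m * 2 ^ (n - a)) / 2 ^ n" unfolding d by simp
  qed
  then show ?thesis unfolding eventually_sequentially by blast
qed

text \<open>The endpoints of any m of the oscillations lie on all sufficiently fine grids, where
  they force jumps worth m * e^2. Only the existence of a late grid index depends on m, so the
  liminf over n is infinite.\<close>

lemma anchor_jumps_unbounded_if_oscillates: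
  assumes "e > 0" "oscillates (2 * e) x"
  shows "\<forall>\<^sub>F n in sequentially. c \<le> anchor_jumps e (\<lambda>k. x (real k / 2 ^ n)) (4 ^ n)"
proof -
  from assms obtain p q :: "nat \<Rightarrow> real" where disj: "disjoint_family (\<lambda>i. {p i..<q i})"
    and pq: "\<And>i. p i \<in> dyadics \<and> q i \<in> dyadics \<and> p i < q i \<and> 2 * e \<le> \<bar>x (p i) - x (q i)\<bar>"
    unfolding oscillates_def by blast
  obtain m :: nat where m: "c / e\<^sup>2 \<le> real m" using real_arch_simple by blast
  have "\<forall>\<^sub>F n in sequentially. \<forall>i\<in>{..<m}. (\<exists>k\<le>4 ^ n. p i = real k / 2 ^ n) \<and> (\<exists>k\<le>4 ^ n. q i = real k / 2 ^ n)"
    by (intro eventually_ball_finite ballI eventually_conj dyadic_grid_index) (use pq in auto)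
  then show ?thesis
  proof eventually_elim
    case (elim n)
    then obtain P Q where PQ: "\<And>i. i < m \<Longrightarrow> P i \<le> 4 ^ n \<and> p i = real (P i) / 2 ^ n"
      "\<And>i. i < m \<Longrightarrow> Q i \<le> 4 ^ n \<and> q i = real (Q i) / 2 ^ n"
      by (metis lessThan_iff)
    have disj': "disjoint_family_on (\<lambda>i. {P i..<Q i}) {..<m}"
      unfolding disjoint_family_on_def
    proof (intro ballI impI equals0I)
      fix i j k assume *: "i \<in> {..<m}" "j \<in> {..<m}" "i \<noteq> j" "k \<in> {P i..<Q i} \<inter> {P j..<Q j}"
      then have "real k / 2 ^ n \<in> {p i..<q i} \<inter> {p j..<q j}"
        using PQ[of i] PQ[of j] by (auto simp: divide_right_mono divide_strict_right_mono)
      with disj \<open>i \<noteq> j\<close> show False unfolding disjoint_family_on_def by blast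
    qed
    have "c \<le> real m * e\<^sup>2" using m \<open>e > 0\<close> by (simp add: field_simps)
    also have "\<dots> \<le> anchor_jumps e (\<lambda>k. x (real k / 2 ^ n)) (4 ^ n)"
    proof (rule anchor_jumps_ge_oscillations[OF \<open>e > 0\<close> disj'])
      fix i assume "i < m"
      then show "P i < Q i \<and> Q i \<le> 4 ^ n \<and> 2 * e \<le> \<bar>x (real (P i) / 2 ^ n) - x (real (Q i) / 2 ^ n)\<bar>"
        using pq[of i] PQ[of i] by (auto simp: divide_less_cancel)
    qed
    finally show ?case .
  qed
qed

text \<open>Floor plus one rather than ceiling: the result lies strictly above r even if r is itself
  on the grid, so the value at r never influences the right limit.\<close>

definition dyadic_above :: "nat \<Rightarrow> real \<Rightarrow> real" where
  "dyadic_above n r = (of_int \<lfloor>r * 2 ^ n\<rfloor> + 1) / 2 ^ n"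

lemma dyadic_above_greater: "r < dyadic_above n r"
  unfolding dyadic_above_def by (simp add: pos_less_divide_eq)

lemma dyadic_above_le: "dyadic_above n r \<le> r + (1/2) ^ n"
  unfolding dyadic_above_def by (simp add: field_simps power_divide)

lemma dyadic_above_in_dyadics:
  assumes "0 \<le> r" shows "dyadic_above n r \<in> dyadics"
proof -
  have "dyadic_above n r = of_nat (nat \<lfloor>r * 2 ^ n\<rfloor> + 1) / 2 ^ n"
    using assms by (simp add: dyadic_above_def)
  then show ?thesis unfolding dyadics_def by blast
qed

lemma dyadic_above_tendsto: "(\<lambda>n. dyadic_above n r) \<longlonglongrightarrow> r"
proof (rule tendsto_sandwich[where f = "\<lambda>_. r" and h = "\<lambda>n. r + (1/2) ^ n"])
  show "(\<lambda>n. r + (1/2) ^ n) \<longlonglongrightarrow> r"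
    using tendsto_add[OF tendsto_const[of r] LIMSEQ_realpow_zero[of "1/2"]] by simp
qed (auto simp: less_imp_le[OF dyadic_above_greater] dyadic_above_le intro!: tendsto_const)

lemma eventually_dyadic_above_less:
  assumes "r < u" shows "\<forall>\<^sub>F n in sequentially. dyadic_above n r < u"
  using dyadic_above_tendsto assms by (rule order_tendstoD)

section \<open>Disjoint intervals and one-sided stability of paths\<close>

lemma disjoint_family_consecutive:
  fixes p q :: "nat \<Rightarrow> real"
  assumes "\<And>i. p i < q i" "\<And>i. q i \<le> p (Suc i)"
  shows "disjoint_family (\<lambda>i. {p i..<q i})"
proof -
  have *: "q i \<le> p j" if "i < j" for i j
    using that
  proof (induction rule: strict_inc_induct)
    case (step i) then show ?case using assms(1)[of "Suc i"] assms(2)[of i] by linarith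
  qed (use assms(2) in auto)
  then show ?thesis unfolding disjoint_family_on_def
    by (metis (no_types, opaque_lifting) Int_emptyI atLeastLessThan_iff leD linorder_neqE_nat order_less_le_trans)
qed

lemma disjoint_family_consecutive_decreasing:
  fixes p q :: "nat \<Rightarrow> real"
  assumes "\<And>i. p i < q i" "\<And>i. q (Suc i) \<le> p i"
  shows "disjoint_family (\<lambda>i. {p i..<q i})"
proof -
  have *: "q j \<le> p i" if "i < j" for i j
    using that
  proof (induction rule: strict_inc_induct)
    case (step i) then show ?case using assms(1)[of "Suc i"] assms(2)[of i] by linarith
  qed (use assms(2) in auto)
  then show ?thesis unfolding disjoint_family_on_def
    by (metis (no_types, opaque_lifting) Int_emptyI atLeastLessThan_iff leD linorder_neqE_nat order_less_le_trans)
qed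

text \<open>If every right neighbourhood of r held a pair of dyadics with values e apart, pairs
  could be chosen successively, each to the left of the one before, and their intervals would be the
  disjoint family of an oscillation.\<close>

lemma right_stable_if_not_oscillates:
  assumes "e > 0" "\<not> oscillates e x"
  shows "\<exists>b>r. \<forall>p\<in>dyadics \<inter> {r<..<b}. \<forall>q\<in>dyadics \<inter> {r<..<b}. \<bar>x p - x q\<bar> < e"
proof (rule ccontr)
  assume neg: "\<not> ?thesis"
  let ?osc = "\<lambda>p q. p \<in> dyadics \<and> q \<in> dyadics \<and> r < p \<and> p < q \<and> e \<le> \<bar>x p - x q\<bar>"
  have ex: "\<exists>p q. ?osc p q \<and> q < b" if "r < b" for b
  proof -
    have "\<exists>p\<in>dyadics \<inter> {r<..<b}. \<exists>q\<in>dyadics \<inter> {r<..<b}. \<not> \<bar>x p - x q\<bar> < e"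
      using neg that by meson
    then obtain p q where pq: "p \<in> dyadics" "q \<in> dyadics" "r < p" "r < q" "p < b" "q < b" "e \<le> \<bar>x p - x q\<bar>"
      by (auto simp: not_less)
    consider "p < q" | "q < p" using pq \<open>e > 0\<close> by (cases p q rule: linorder_cases) auto
    then show ?thesis using pq by cases (metis abs_minus_commute)+
  qed
  have "\<exists>f. \<forall>i. ?osc (fst (f i)) (snd (f i)) \<and> snd (f (Suc i)) \<le> fst (f i)"
  proof (rule dependent_nat_choice[where P = "\<lambda>_ f. ?osc (fst f) (snd f)" and Q = "\<lambda>_ f g. snd g \<le> fst f"])
    show "\<exists>f. ?osc (fst f) (snd f)" using ex[of "r + 1"] by auto
  next
    fix f :: "real \<times> real" assume "?osc (fst f) (snd f)"
    then obtain p q where "?osc p q \<and> q < fst f" using ex by blast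
    then show "\<exists>g. ?osc (fst g) (snd g) \<and> snd g \<le> fst f" by (intro exI[of _ "(p, q)"]) auto
  qed
  then obtain f where f: "\<And>i. ?osc (fst (f i)) (snd (f i))" "\<And>i. snd (f (Suc i)) \<le> fst (f i)"
    by blast
  have "disjoint_family (\<lambda>i. {fst (f i)..<snd (f i)})"
    by (rule disjoint_family_consecutive_decreasing) (use f in auto)
  with f(1) have "oscillates e x" unfolding oscillates_def
    by (intro exI[of _ "\<lambda>i. fst (f i)"] exI[of _ "\<lambda>i. snd (f i)"]) auto
  with assms(2) show False by blast
qed

lemma left_stable_if_not_oscillates:
  assumes "e > 0" "\<not> oscillates e x"
  shows "\<exists>a<r. \<forall>p\<in>dyadics \<inter> {a<..<r}. \<forall>q\<in>dyadics \<inter> {a<..<r}. \<bar>x p - x q\<bar> < e"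
proof (rule ccontr)
  assume neg: "\<not> ?thesis"
  let ?osc = "\<lambda>p q. p \<in> dyadics \<and> q \<in> dyadics \<and> p < q \<and> q < r \<and> e \<le> \<bar>x p - x q\<bar>"
  have ex: "\<exists>p q. ?osc p q \<and> a < p" if "a < r" for a
  proof -
    have "\<exists>p\<in>dyadics \<inter> {a<..<r}. \<exists>q\<in>dyadics \<inter> {a<..<r}. \<not> \<bar>x p - x q\<bar> < e"
      using neg that by meson
    then obtain p q where pq: "p \<in> dyadics" "q \<in> dyadics" "p < r" "q < r" "a < p" "a < q" "e \<le> \<bar>x p - x q\<bar>"
      by (auto simp: not_less)
    consider "p < q" | "q < p" using pq \<open>e > 0\<close> by (cases p q rule: linorder_cases) auto
    then show ?thesis using pq by cases (metis abs_minus_commute)+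
  qed
  have "\<exists>f. \<forall>i. ?osc (fst (f i)) (snd (f i)) \<and> snd (f i) \<le> fst (f (Suc i))"
  proof (rule dependent_nat_choice[where P = "\<lambda>_ f. ?osc (fst f) (snd f)" and Q = "\<lambda>_ f g. snd f \<le> fst g"])
    show "\<exists>f. ?osc (fst f) (snd f)" using ex[of "r - 1"] by auto
  next
    fix f :: "real \<times> real" assume "?osc (fst f) (snd f)"
    then obtain p q where "?osc p q \<and> snd f < p" using ex by blast
    then show "\<exists>g. ?osc (fst g) (snd g) \<and> snd f \<le> fst g" by (intro exI[of _ "(p, q)"]) auto
  qed
  then obtain f where f: "\<And>i. ?osc (fst (f i)) (snd (f i))" "\<And>i. snd (f i) \<le> fst (f (Suc i))"
    by blast
  have "disjoint_family (\<lambda>i. {fst (f i)..<snd (f i)})"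
    by (rule disjoint_family_consecutive) (use f in auto)
  with f(1) have "oscillates e x" unfolding oscillates_def
    by (intro exI[of _ "\<lambda>i. fst (f i)"] exI[of _ "\<lambda>i. snd (f i)"]) auto
  with assms(2) show False by blast
qed

text \<open>A limit along one fixed sequence is measurable in the outcome; at outcomes without
  convergence \<open>lim\<close> still returns some value.\<close>

definition right_limit :: "(real \<Rightarrow> real) \<Rightarrow> real \<Rightarrow> real" where
  "right_limit x r = lim (\<lambda>n. x (dyadic_above n r))"

lemma dyadic_above_tendsto_right_limit:
  assumes "\<And>e. e > 0 \<Longrightarrow> \<not> oscillates e x" "0 \<le> r"
  shows "(\<lambda>n. x (dyadic_above n r)) \<longlonglongrightarrow> right_limit x r"
proof -
  have "Cauchy (\<lambda>n. x (dyadic_above n r))"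
  proof (rule metric_CauchyI)
    fix e :: real assume "e > 0"
    then obtain b where b: "b > r"
      "\<forall>p\<in>dyadics \<inter> {r<..<b}. \<forall>q\<in>dyadics \<inter> {r<..<b}. \<bar>x p - x q\<bar> < e"
      using right_stable_if_not_oscillates[OF _ assms(1)] by blast
    obtain N where "\<And>n. n \<ge> N \<Longrightarrow> dyadic_above n r < b"
      using eventually_dyadic_above_less[OF b(1)] by (auto simp: eventually_sequentially)
    then show "\<exists>M. \<forall>m\<ge>M. \<forall>n\<ge>M. dist (x (dyadic_above m r)) (x (dyadic_above n r)) < e"
      using b(2) dyadic_above_in_dyadics[OF assms(2)] dyadic_above_greater
      unfolding dist_real_def by (intro exI[of _ N]) auto
  qed
  then show ?thesis
    unfolding right_limit_def by (simp add: Cauchy_convergent convergent_LIMSEQ_iff[symmetric])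
qed

text \<open>Weak inequality suffices at the left end, since \<open>dyadic_above\<close> exceeds its
  argument strictly and hence lands in the open interval. Thus \<open>a = r\<close> is allowed,
  which is the instance behind right continuity at r.\<close>

lemma right_limit_close:
  assumes "\<And>e. e > 0 \<Longrightarrow> \<not> oscillates e x" "0 \<le> r" "a \<le> r" "r < b" "0 \<le> s" "a \<le> s" "s < b"
    and b: "\<forall>p\<in>dyadics \<inter> {a<..<b}. \<forall>q\<in>dyadics \<inter> {a<..<b}. \<bar>x p - x q\<bar> < e"
  shows "\<bar>right_limit x r - right_limit x s\<bar> \<le> e"
proof (rule tendsto_upperbound)
  show "(\<lambda>n. \<bar>x (dyadic_above n r) - x (dyadic_above n s)\<bar>) \<longlonglongrightarrow> \<bar>right_limit x r - right_limit x s\<bar>"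
    by (intro tendsto_intros dyadic_above_tendsto_right_limit) (use assms in auto)
  show "\<forall>\<^sub>F n in sequentially. \<bar>x (dyadic_above n r) - x (dyadic_above n s)\<bar> \<le> e"
    using eventually_dyadic_above_less[OF \<open>r < b\<close>] eventually_dyadic_above_less[OF \<open>s < b\<close>]
  proof eventually_elim
    case (elim n)
    then show ?case
      using b dyadic_above_in_dyadics[OF \<open>0 \<le> r\<close>, of n] dyadic_above_in_dyadics[OF \<open>0 \<le> s\<close>, of n]
        dyadic_above_greater[of r n] dyadic_above_greater[of s n] assms
      by (intro less_imp_le) (auto intro!: b[rule_format])
  qed
qed simp

lemma cadlag_right_limit:
  assumes "\<And>e. e > 0 \<Longrightarrow> \<not> oscillates e x"
  shows "cadlag (right_limit x)"
  unfolding cadlag_def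
proof (intro conjI allI impI)
  fix r :: real assume "0 \<le> r"
  show "(right_limit x \<longlongrightarrow> right_limit x r) (at_right r)"
  proof (rule tendstoI)
    fix e :: real assume "e > 0"
    then obtain b where b: "b > r"
      "\<forall>p\<in>dyadics \<inter> {r<..<b}. \<forall>q\<in>dyadics \<inter> {r<..<b}. \<bar>x p - x q\<bar> < e/2"
      using right_stable_if_not_oscillates[of "e/2"] assms half_gt_zero by meson
    have "\<forall>\<^sub>F s in at_right r. s \<in> {r<..<b}"
      using b(1) by (rule eventually_at_right_real)
    then show "\<forall>\<^sub>F s in at_right r. dist (right_limit x s) (right_limit x r) < e"
    proof eventually_elim
      case (elim s)
      have "\<bar>right_limit x s - right_limit x r\<bar> \<le> e/2"
        by (rule right_limit_close[OF assms _ _ _ _ _ _ b(2)]) (use elim \<open>0 \<le> r\<close> in auto)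
      with \<open>e > 0\<close> show ?case by (auto simp: dist_real_def)
    qed
  qed
next
  fix r :: real assume "0 < r"
  \<comment> \<open>The bound \<open>max a 0\<close> keeps all times nonnegative, where the dyadic
    approximations are members of \<open>dyadics\<close>.\<close>
  have stable: "\<exists>a\<ge>0. a < r \<and> (\<forall>s\<in>{a<..<r}. \<forall>s'\<in>{a<..<r}. \<bar>right_limit x s - right_limit x s'\<bar> \<le> e)"
    if "e > 0" for e
  proof -
    obtain a where a: "a < r"
      "\<forall>p\<in>dyadics \<inter> {a<..<r}. \<forall>q\<in>dyadics \<inter> {a<..<r}. \<bar>x p - x q\<bar> < e"
      using left_stable_if_not_oscillates[OF \<open>e > 0\<close> assms[OF \<open>e > 0\<close>]] by blast
    have "\<bar>right_limit x s - right_limit x s'\<bar> \<le> e" if "s \<in> {max a 0<..<r}" "s' \<in> {max a 0<..<r}" for s s'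
      by (rule right_limit_close[OF assms _ _ _ _ _ _ a(2)]) (use that in auto)
    then show ?thesis using a(1) \<open>0 < r\<close> by (intro exI[of _ "max a 0"]) auto
  qed
  \<comment> \<open>This sequence supplies the candidate for the left limit. Early terms may be
    negative, but only its tail, inside \<open>{a<..<r}\<close> with a nonnegative \<open>a\<close>,
    matters.\<close>
  let ?z = "\<lambda>n. r - 1 / real (Suc n)"
  have z: "\<forall>\<^sub>F n in sequentially. ?z n \<in> {a<..<r}" if "a < r" for a
  proof -
    have "?z \<longlonglongrightarrow> r - 0" by (intro tendsto_intros LIMSEQ_Suc lim_1_over_n)
    then have "\<forall>\<^sub>F n in sequentially. a < ?z n" using that by (auto dest: order_tendstoD)
    then show ?thesis by simp
  qed
  have "Cauchy (\<lambda>n. right_limit x (?z n))"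
  proof (rule metric_CauchyI)
    fix e :: real assume "e > 0"
    then obtain a where a: "a < r"
        "\<forall>s\<in>{a<..<r}. \<forall>s'\<in>{a<..<r}. \<bar>right_limit x s - right_limit x s'\<bar> \<le> e/2"
      using stable half_gt_zero by meson
    obtain N where N: "\<And>n. n \<ge> N \<Longrightarrow> ?z n \<in> {a<..<r}" using z[OF a(1)] by (auto simp: eventually_sequentially)
    have "dist (right_limit x (?z m)) (right_limit x (?z n)) < e" if "m \<ge> N" "n \<ge> N" for m n
      using a(2)[rule_format, OF N[OF that(1)] N[OF that(2)]] \<open>e > 0\<close> by (simp add: dist_real_def)
    then show "\<exists>M. \<forall>m\<ge>M. \<forall>n\<ge>M. dist (right_limit x (?z m)) (right_limit x (?z n)) < e" by blast
  qed
  then obtain l where l: "(\<lambda>n. right_limit x (?z n)) \<longlonglongrightarrow> l"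
    using Cauchy_convergent convergent_def by blast
  have "(right_limit x \<longlongrightarrow> l) (at_left r)"
  proof (rule tendstoI)
    fix e :: real assume "e > 0"
    then obtain a where a: "a < r"
        "\<forall>s\<in>{a<..<r}. \<forall>s'\<in>{a<..<r}. \<bar>right_limit x s - right_limit x s'\<bar> \<le> e/2"
      using stable half_gt_zero by meson
    have "\<forall>\<^sub>F s in at_left r. s \<in> {a<..<r}"
      using a(1) by (rule eventually_at_left_real)
    then show "\<forall>\<^sub>F s in at_left r. dist (right_limit x s) l < e"
    proof eventually_elim
      case (elim s)
      have "\<bar>right_limit x s - l\<bar> \<le> e/2"
      proof (rule tendsto_upperbound)
        show "(\<lambda>n. \<bar>right_limit x s - right_limit x (?z n)\<bar>) \<longlonglongrightarrow> \<bar>right_limit x s - l\<bar>"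
          by (intro tendsto_intros l)
        show "\<forall>\<^sub>F n in sequentially. \<bar>right_limit x s - right_limit x (?z n)\<bar> \<le> e/2"
          using z[OF a(1)] by eventually_elim (use a(2) elim in auto)
      qed simp
      with \<open>e > 0\<close> show ?case by (auto simp: dist_real_def)
    qed
  qed
  then show "\<exists>l. (right_limit x \<longlongrightarrow> l) (at_left r)" by blast
qed

section \<open>Cadlag versions of bounded martingales\<close>

lemma oscillates_mono: "oscillates e x \<Longrightarrow> e' \<le> e \<Longrightarrow> oscillates e' x"
  unfolding oscillates_def by (meson order_trans)

lemma cadlag_clip:
  assumes "cadlag f" shows "cadlag (\<lambda>t. max 0 (min 1 (f t)))"
proof -
  have clip: "((\<lambda>t. max 0 (min 1 (f t))) \<longlongrightarrow> max 0 (min 1 l)) A" if "(f \<longlongrightarrow> l) A" for l A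
    by (intro tendsto_max tendsto_min tendsto_const that)
  show ?thesis
    unfolding cadlag_def
  proof (intro conjI allI impI)
    fix t :: real assume "0 \<le> t"
    with assms show "((\<lambda>t. max 0 (min 1 (f t))) \<longlongrightarrow> max 0 (min 1 (f t))) (at_right t)"
      by (intro clip) (simp add: cadlag_def)
  next
    fix t :: real assume "0 < t"
    with assms obtain l where "(f \<longlongrightarrow> l) (at_left t)" by (auto simp: cadlag_def)
    then show "\<exists>l. ((\<lambda>t. max 0 (min 1 (f t))) \<longlongrightarrow> l) (at_left t)" using clip by blast
  qed
qed

text \<open>The anchor at k is \<open>H k\<close>-measurable with values in [0,1], so it is a
  legitimate test function in \<open>mart\<close> and every summand of the stochastic integral has
  mean zero. What remains in the identity is at most \<open>(Y n \<omega>)\<close> squared, hence at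
  most 1.\<close>

lemma (in prob_space) expectation_anchor_jumps_le_1:
  fixes Y :: "nat \<Rightarrow> 'a \<Rightarrow> real"
  assumes sub: "\<And>k. subalgebra M (H k)" "\<And>k. subalgebra (H (Suc k)) (H k)"
    and Y: "\<And>k. Y k \<in> borel_measurable (H k)" "\<And>k \<omega>. Y k \<omega> \<in> {0..1}"
    and mart: "\<And>k g. g \<in> borel_measurable (H k) \<Longrightarrow> (\<And>\<omega>. g \<omega> \<in> {0..1}) \<Longrightarrow>
      (\<integral>\<omega>. g \<omega> * Y (Suc k) \<omega> \<partial>M) = (\<integral>\<omega>. g \<omega> * Y k \<omega> \<partial>M)"
  shows "(\<integral>\<^sup>+\<omega>. anchor_jumps e (\<lambda>k. Y k \<omega>) n \<partial>M) \<le> 1"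
proof -
  let ?R = "\<lambda>k \<omega>. anchor e (\<lambda>k. Y k \<omega>) k"
  have R: "?R k \<in> borel_measurable (H k)" for k
  proof (induction k)
    case (Suc k)
    note [measurable] = measurable_from_subalg[OF sub(2) Suc] Y(1)[of "Suc k"]
    show ?case by simp
  qed (use Y(1) in simp)
  have R01: "?R k \<omega> \<in> {0..1}" for k \<omega> by (rule anchor_range) (rule Y)
  note [measurable] = measurable_from_subalg[OF sub(1) R] measurable_from_subalg[OF sub(1) Y(1)]
  have int: "integrable M (\<lambda>\<omega>. ?R k \<omega> * Y j \<omega>)" for j k
  proof (rule integrable_const_bound[of _ 1])
    show "AE \<omega> in M. norm (?R k \<omega> * Y j \<omega>) \<le> 1"
      using R01 Y(2) by (auto simp: abs_mult intro!: mult_le_one)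
  qed simp
  have le: "anchor_jumps e (\<lambda>k. Y k \<omega>) n \<le> 1 - 2 * (\<Sum>k<n. ?R k \<omega> * Y (Suc k) \<omega> - ?R k \<omega> * Y k \<omega>)" for \<omega>
  proof -
    have "(Y n \<omega>)\<^sup>2 \<le> 1" using Y(2)[of n \<omega>] by (simp add: power_le_one)
    moreover have "0 \<le> (Y 0 \<omega>)\<^sup>2" "0 \<le> (Y n \<omega> - ?R n \<omega>)\<^sup>2" by simp_all
    ultimately show ?thesis
      using anchor_jumps_identity[of e "\<lambda>k. Y k \<omega>" n] unfolding right_diff_distrib by linarith
  qed
  have "(\<integral>\<^sup>+\<omega>. anchor_jumps e (\<lambda>k. Y k \<omega>) n \<partial>M)
      \<le> (\<integral>\<^sup>+\<omega>. ennreal (1 - 2 * (\<Sum>k<n. ?R k \<omega> * Y (Suc k) \<omega> - ?R k \<omega> * Y k \<omega>)) \<partial>M)"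
    by (intro nn_integral_mono ennreal_leI le)
  also have "\<dots> = ennreal (\<integral>\<omega>. 1 - 2 * (\<Sum>k<n. ?R k \<omega> * Y (Suc k) \<omega> - ?R k \<omega> * Y k \<omega>) \<partial>M)"
    by (rule nn_integral_eq_integral)
       (use int order_trans[OF anchor_jumps_nonneg le] in auto)
  also have "(\<integral>\<omega>. 1 - 2 * (\<Sum>k<n. ?R k \<omega> * Y (Suc k) \<omega> - ?R k \<omega> * Y k \<omega>) \<partial>M) = 1"
    using int mart[OF R R01] by (simp add: prob_space)
  finally show ?thesis by simp
qed

text \<open>The jump sums need not increase under refinement of the grid, since one large jump can
  split into smaller ones with a smaller sum of squares. Fatou's lemma takes the place of monotone
  convergence: the liminf has mean at most 1 and is finite almost surely, whereas an oscillation
  would make it infinite.\<close>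

lemma (in prob_space) AE_not_oscillates:
  fixes C :: "real \<Rightarrow> 'a \<Rightarrow> real"
  assumes filt: "filtration_of M F"
    and C: "\<And>q. 0 \<le> q \<Longrightarrow> C q \<in> borel_measurable (F q)" "\<And>q \<omega>. C q \<omega> \<in> {0..1}"
    and mart: "\<And>q r g. 0 \<le> q \<Longrightarrow> q \<le> r \<Longrightarrow> g \<in> borel_measurable (F q) \<Longrightarrow> (\<And>\<omega>. g \<omega> \<in> {0..1}) \<Longrightarrow>
      (\<integral>\<omega>. g \<omega> * C r \<omega> \<partial>M) = (\<integral>\<omega>. g \<omega> * C q \<omega> \<partial>M)"
  shows "AE \<omega> in M. \<forall>e>0. \<not> oscillates e (\<lambda>q. C q \<omega>)"
proof -
  have sub: "\<And>t. 0 \<le> t \<Longrightarrow> subalgebra M (F t)" "\<And>s t. 0 \<le> s \<Longrightarrow> s \<le> t \<Longrightarrow> subalgebra (F t) (F s)"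
    using filt by (auto simp: filtration_of_def)
  have M[measurable]: "0 \<le> q \<Longrightarrow> C q \<in> borel_measurable M" for q
    using measurable_from_subalg[OF sub(1) C(1)] by blast
  have "AE \<omega> in M. \<not> oscillates (2 * e) (\<lambda>q. C q \<omega>)" if "e > 0" for e
  proof -
    let ?J = "\<lambda>n \<omega>. ennreal (anchor_jumps e (\<lambda>k. C (real k / 2 ^ n) \<omega>) (4 ^ n))"
    have [measurable]: "(\<lambda>\<omega>. anchor e (\<lambda>k. C (real k / 2 ^ n) \<omega>) j) \<in> borel_measurable M" for n j
      by (induction j) auto
    have J[measurable]: "?J n \<in> borel_measurable M" for n
      unfolding anchor_jumps_def by measurable
    have le: "integral\<^sup>N M (?J n) \<le> 1" for n
      by (rule expectation_anchor_jumps_le_1[where H = "\<lambda>k. F (real k / 2 ^ n)"])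
         (use C(2) in \<open>auto intro!: sub C(1) mart divide_right_mono\<close>)
    have "(\<integral>\<^sup>+\<omega>. liminf (\<lambda>n. ?J n \<omega>) \<partial>M) \<le> liminf (\<lambda>n. integral\<^sup>N M (?J n))"
      by (rule nn_integral_liminf) simp
    also have "\<dots> \<le> limsup (\<lambda>n. integral\<^sup>N M (?J n))" by (rule Liminf_le_Limsup) simp
    also have "\<dots> \<le> 1" by (rule Limsup_bounded) (simp add: le)
    finally have "AE \<omega> in M. liminf (\<lambda>n. ?J n \<omega>) \<noteq> \<infinity>"
      by (intro nn_integral_PInf_AE) (auto simp: top_unique)
    then show ?thesis
    proof eventually_elim
      case (elim \<omega>)
      show ?case
      proof
        assume osc: "oscillates (2 * e) (\<lambda>q. C q \<omega>)"
        obtain c where c: "0 \<le> c" "liminf (\<lambda>n. ?J n \<omega>) = ennreal c"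
          using elim by (cases "liminf (\<lambda>n. ?J n \<omega>)") auto
        have "ennreal (c + 1) \<le> liminf (\<lambda>n. ?J n \<omega>)"
          by (rule Liminf_bounded)
             (use anchor_jumps_unbounded_if_oscillates[OF \<open>e > 0\<close> osc, of "c + 1"]
               in \<open>auto elim!: eventually_mono intro: ennreal_leI\<close>)
        with c show False by simp
      qed
    qed
  qed
  \<comment> \<open>Countably many sizes give one null set; any oscillation of size e is also one of
    each smaller size.\<close>
  from this[of "inverse (real (Suc n))" for n]
  have "AE \<omega> in M. \<forall>n. \<not> oscillates (2 * inverse (real (Suc n))) (\<lambda>q. C q \<omega>)"
    by (simp add: AE_all_countable)
  then show ?thesis
  proof eventually_elim
    case (elim \<omega>)
    show ?case
    proof (intro allI impI notI)
      fix e :: real assume e: "e > 0" "oscillates e (\<lambda>q. C q \<omega>)"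
      obtain n where "inverse (real (Suc n)) < e / 2" using reals_Archimedean[of "e/2"] e by auto
      with oscillates_mono[OF e(2), of "2 * inverse (real (Suc n))"] elim show False by auto
    qed
  qed
qed

text \<open>For each u > t the tail of the dyadic sequence stays below u, which makes the limit
  \<open>F u\<close>-measurable; intersecting over u gives \<open>F t\<close>.\<close>

lemma right_limit_measurable:
  assumes rc: "right_continuous_filtration F" and filt: "filtration_of M F"
    and C: "\<And>q. 0 \<le> q \<Longrightarrow> C q \<in> borel_measurable (F q)" and "0 \<le> t"
  shows "(\<lambda>\<omega>. right_limit (\<lambda>q. C q \<omega>) t) \<in> borel_measurable (F t)"
proof -
  have sub: "\<And>s t. 0 \<le> s \<Longrightarrow> s \<le> t \<Longrightarrow> subalgebra (F t) (F s)"
    using filt by (auto simp: filtration_of_def)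
  have "(\<lambda>\<omega>. right_limit (\<lambda>q. C q \<omega>) t) \<in> borel_measurable (F u)" if tu: "t < u" for u
  proof -
    obtain N where N: "\<And>n. n \<ge> N \<Longrightarrow> dyadic_above n t < u"
      using eventually_dyadic_above_less[OF tu] by (auto simp: eventually_sequentially)
    \<comment> \<open>Stated for every candidate l, the equivalence makes the two values of
      \<open>lim\<close> equal at divergent outcomes too.\<close>
    have "(\<lambda>n. C (dyadic_above n t) \<omega>) \<longlonglongrightarrow> l
        \<longleftrightarrow> (\<lambda>n. C (dyadic_above (n + N) t) \<omega>) \<longlonglongrightarrow> l" for l \<omega>
      using LIMSEQ_ignore_initial_segment[of "\<lambda>n. C (dyadic_above n t) \<omega>" l N]
        LIMSEQ_offset[of "\<lambda>n. C (dyadic_above n t) \<omega>" N l] by blast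
    then have "right_limit (\<lambda>q. C q \<omega>) t = lim (\<lambda>n. C (dyadic_above (n + N) t) \<omega>)" for \<omega>
      unfolding right_limit_def lim_def by simp
    moreover have [measurable]: "C (dyadic_above (n + N) t) \<in> borel_measurable (F u)" for n
      using dyadic_above_greater[of t "n + N"] N[of "n + N"] \<open>0 \<le> t\<close>
      by (intro measurable_from_subalg[OF sub C]) auto
    ultimately show ?thesis by simp
  qed
  moreover have "sets (F t) = (\<Inter>u\<in>{t<..}. sets (F u))"
    using rc \<open>0 \<le> t\<close> by (simp add: right_continuous_filtration_def)
  moreover have "space (F u) = space (F t)" if "t < u" for u
    using sub[of t u] that \<open>0 \<le> t\<close> by (simp add: subalgebra_def)
  ultimately show ?thesis by (auto simp: measurable_def)
qed

lemma (in prob_space) sigma_finite_subalgebra_if_subalgebra: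
  assumes "subalgebra M N" shows "sigma_finite_subalgebra M N"
  by (rule finite_measure_subalgebra_is_sigma_finite) (unfold_locales, rule assms)

lemma (in prob_space) cadlag_martingale_version:
  fixes f :: "'a \<Rightarrow> real"
  assumes filt: "filtration_of M F" and rc: "right_continuous_filtration F"
    and f[measurable]: "f \<in> borel_measurable M" and f01: "\<And>\<omega>. f \<omega> \<in> {0..1}"
  obtains X where "supermartingale M F X" "\<And>t \<omega>. 0 \<le> X t \<omega>"
    "\<And>t. 0 \<le> t \<Longrightarrow> AE \<omega> in M. real_cond_exp M (F t) f \<omega> = X t \<omega>"
proof -
  have sub: "\<And>t. 0 \<le> t \<Longrightarrow> subalgebra M (F t)" "\<And>s t. 0 \<le> s \<Longrightarrow> s \<le> t \<Longrightarrow> subalgebra (F t) (F s)"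
    using filt by (auto simp: filtration_of_def)
  have int_f: "integrable M f"
    by (rule integrable_const_bound[of _ 1]) (use f01 in auto)
  \<comment> \<open>Clipping changes the conditional expectation only on a null set, because f lies
    in [0,1], and gives bounds valid at every outcome.\<close>
  define C where "C q \<omega> = max 0 (min 1 (real_cond_exp M (F q) f \<omega>))" for q \<omega>
  have C_F: "C q \<in> borel_measurable (F q)" for q unfolding C_def by measurable
  have C01: "C q \<omega> \<in> {0..1}" for q \<omega> by (auto simp: C_def)
  have C_M[measurable]: "C q \<in> borel_measurable M" if "0 \<le> q" for q
    by (rule measurable_from_subalg[OF sub(1)[OF that] C_F])
  have C_int: "(\<integral>\<omega>. g \<omega> * C q \<omega> \<partial>M) = (\<integral>\<omega>. g \<omega> * f \<omega> \<partial>M)"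
    if "0 \<le> q" and g: "g \<in> borel_measurable (F q)" "\<And>\<omega>. g \<omega> \<in> {0..1}" for q g
  proof -
    interpret sf: sigma_finite_subalgebra M "F q"
      by (rule sigma_finite_subalgebra_if_subalgebra[OF sub(1)[OF \<open>0 \<le> q\<close>]])
    note [measurable] = measurable_from_subalg[OF sub(1)[OF \<open>0 \<le> q\<close>] g(1)]
    have "AE \<omega> in M. C q \<omega> = real_cond_exp M (F q) f \<omega>"
      using sf.real_cond_exp_ge_c[OF int_f, of 0] sf.real_cond_exp_le_c[OF int_f, of 1] f01
      by (auto simp: C_def)
    then have "(\<integral>\<omega>. g \<omega> * C q \<omega> \<partial>M) = (\<integral>\<omega>. g \<omega> * real_cond_exp M (F q) f \<omega> \<partial>M)"
      using \<open>0 \<le> q\<close> by (intro integral_cong_AE) auto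
    also have "\<dots> = (\<integral>\<omega>. g \<omega> * f \<omega> \<partial>M)"
    proof (rule sf.real_cond_exp_intg(2)[OF _ g(1) f])
      show "integrable M (\<lambda>\<omega>. g \<omega> * f \<omega>)"
        by (rule integrable_const_bound[of _ 1])
           (use g(2) f01 in \<open>auto simp: abs_mult intro!: mult_le_one\<close>)
    qed
    finally show ?thesis .
  qed
  have C_mart: "(\<integral>\<omega>. g \<omega> * C r \<omega> \<partial>M) = (\<integral>\<omega>. g \<omega> * C q \<omega> \<partial>M)"
    if "0 \<le> q" "q \<le> r" "g \<in> borel_measurable (F q)" "\<And>\<omega>. g \<omega> \<in> {0..1}" for q r g
    using C_int[OF that(1,3,4)]
      C_int[OF order_trans[OF that(1,2)] measurable_from_subalg[OF sub(2)[OF that(1,2)] that(3)] that(4)]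
    by simp
  have no_osc: "AE \<omega> in M. \<forall>e>0. \<not> oscillates e (\<lambda>q. C q \<omega>)"
    by (rule AE_not_oscillates[OF filt C_F C01 C_mart])
  \<comment> \<open>This second clip controls the arbitrary value of \<open>lim\<close> at divergent
    outcomes. Where the sequence converges it changes nothing.\<close>
  define X where "X t \<omega> = max 0 (min 1 (right_limit (\<lambda>q. C q \<omega>) t))" for t \<omega>
  have X_F: "X t \<in> borel_measurable (F t)" if "0 \<le> t" for t
    using right_limit_measurable[OF rc filt C_F that] unfolding X_def by simp
  have X_M[measurable]: "X t \<in> borel_measurable M" if "0 \<le> t" for t
    by (rule measurable_from_subalg[OF sub(1)[OF that] X_F[OF that]])
  have int_X: "integrable M (X t)" if "0 \<le> t" for t
    by (rule integrable_const_bound[of _ 1]) (use that in \<open>auto simp: X_def\<close>)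
  have lim: "AE \<omega> in M. (\<lambda>n. C (dyadic_above n t) \<omega>) \<longlonglongrightarrow> X t \<omega>" if "0 \<le> t" for t
    using no_osc
  proof eventually_elim
    case (elim \<omega>)
    have l: "(\<lambda>n. C (dyadic_above n t) \<omega>) \<longlonglongrightarrow> right_limit (\<lambda>q. C q \<omega>) t"
      by (rule dyadic_above_tendsto_right_limit) (use elim that in auto)
    have "(\<lambda>n. max 0 (min 1 (C (dyadic_above n t) \<omega>))) \<longlonglongrightarrow> X t \<omega>"
      unfolding X_def by (intro tendsto_intros l)
    then show ?case by (simp add: C_def)
  qed
  \<comment> \<open>Since A belongs to the sigma-algebras at all times above t, the integrals of C
    over A along the dyadics all equal that of f. Dominated convergence passes this to
    \<open>X t\<close>, which is therefore again a conditional expectation at t.\<close>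
  have X_int: "(\<integral>\<omega>\<in>A. X t \<omega> \<partial>M) = (\<integral>\<omega>\<in>A. f \<omega> \<partial>M)" if "0 \<le> t" and A: "A \<in> sets (F t)" for t A
  proof -
    have above: "t \<le> dyadic_above n t" for n using dyadic_above_greater[of t n] by simp
    have [measurable]: "A \<in> sets M" using sub(1)[OF \<open>0 \<le> t\<close>] A by (auto simp: subalgebra_def)
    have "(\<lambda>n. \<integral>\<omega>. indicator A \<omega> * C (dyadic_above n t) \<omega> \<partial>M) \<longlonglongrightarrow> (\<integral>\<omega>. indicator A \<omega> * X t \<omega> \<partial>M)"
    proof (rule integral_dominated_convergence[where w = "\<lambda>_. 1"])
      show "AE \<omega> in M. (\<lambda>n. indicator A \<omega> * C (dyadic_above n t) \<omega>) \<longlonglongrightarrow> indicator A \<omega> * X t \<omega>"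
        using lim[OF \<open>0 \<le> t\<close>] by eventually_elim (intro tendsto_intros)
      show "AE \<omega> in M. norm (indicator A \<omega> * C (dyadic_above n t) \<omega>) \<le> 1" for n
        using C01 by (auto simp: indicator_def)
      show "(\<lambda>\<omega>. indicator A \<omega> * C (dyadic_above n t) \<omega>) \<in> borel_measurable M" for n
        using above[of n] \<open>0 \<le> t\<close> by simp
    qed (use \<open>0 \<le> t\<close> in auto)
    moreover have "(\<integral>\<omega>. indicator A \<omega> * C (dyadic_above n t) \<omega> \<partial>M) = (\<integral>\<omega>. indicator A \<omega> * f \<omega> \<partial>M)" for n
    proof (rule C_int)
      show "indicator A \<in> borel_measurable (F (dyadic_above n t))"
        using sub(2)[OF \<open>0 \<le> t\<close> above] A by (auto simp: subalgebra_def intro!: borel_measurable_indicator)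
    qed (use above[of n] \<open>0 \<le> t\<close> in \<open>auto simp: indicator_def\<close>)
    ultimately show ?thesis
      by (simp add: set_lebesgue_integral_def LIMSEQ_const_iff)
  qed
  show thesis
  proof
    show "AE \<omega> in M. real_cond_exp M (F t) f \<omega> = X t \<omega>" if "0 \<le> t" for t
    proof -
      interpret sigma_finite_subalgebra M "F t"
        by (rule sigma_finite_subalgebra_if_subalgebra[OF sub(1)[OF \<open>0 \<le> t\<close>]])
      show ?thesis
        by (rule real_cond_exp_charact) (auto simp: X_int X_F int_X int_f that)
    qed
    show "0 \<le> X t \<omega>" for t \<omega> by (simp add: X_def)
    have "AE \<omega> in M. real_cond_exp M (F s) (X t) \<omega> \<le> X s \<omega>" if "0 \<le> s" "s \<le> t" for s t
    proof -
      interpret sigma_finite_subalgebra M "F s"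
        by (rule sigma_finite_subalgebra_if_subalgebra[OF sub(1)[OF \<open>0 \<le> s\<close>]])
      have "A \<in> sets (F t)" if "A \<in> sets (F s)" for A
        using sub(2)[OF \<open>0 \<le> s\<close> \<open>s \<le> t\<close>] that by (auto simp: subalgebra_def)
      then have "AE \<omega> in M. real_cond_exp M (F s) (X t) \<omega> = X s \<omega>"
        using that by (intro real_cond_exp_charact) (auto simp: X_int X_F int_X)
      then show ?thesis by eventually_elim simp
    qed
    moreover have "as_cadlag M X"
      unfolding as_cadlag_def using no_osc
      by eventually_elim (auto simp: X_def intro!: cadlag_clip cadlag_right_limit)
    ultimately show "supermartingale M F X"
      unfolding supermartingale_def adapted_to_def using X_F int_X by blast
  qed
qed

section \<open>Comparison on a generating algebra\<close>

text \<open>Countability lets the null sets of the individual comparisons be united; the algebra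
  structure is what approximation in measure requires. Closing under complements and pairwise unions
  countably often preserves countability.\<close>

lemma countable_generating_algebra:
  assumes "countable A" "A \<subseteq> Pow \<Omega>"
  obtains B where "countable B" "algebra \<Omega> B" "sigma_sets \<Omega> A = sigma_sets \<Omega> B"
proof -
  define step where "step S = S \<union> (\<lambda>a. \<Omega> - a) ` S \<union> (\<lambda>(a, b). a \<union> b) ` (S \<times> S)" for S :: "'a set set"
  define L where "L n = (step ^^ n) (insert {} A)" for n
  define B where "B = (\<Union>n. L n)"
  have L0: "L 0 = insert {} A" and LS: "L (Suc n) = step (L n)" for n
    by (simp_all add: L_def)
  have cnt: "countable (L n)" for n
  proof (induction n)
    case (Suc n) then show ?case unfolding LS step_def by blast
  qed (simp add: L0 assms)
  have sig: "L n \<subseteq> sigma_sets \<Omega> A" for n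
  proof (induction n)
    case (Suc n) then show ?case unfolding LS step_def
      by (auto intro: sigma_sets.Compl sigma_sets_Un)
  qed (auto simp: L0 intro: sigma_sets.intros)
  have inc: "L m \<subseteq> L n" if "m \<le> n" for m n
    using that by (rule lift_Suc_mono_le[rotated]) (auto simp: LS step_def)
  have alg: "algebra \<Omega> B"
    unfolding algebra_iff_Un
  proof (intro conjI ballI)
    show "B \<subseteq> Pow \<Omega>" using sig sigma_sets_into_sp[OF assms(2)] unfolding B_def by blast
    show "{} \<in> B" using L0 unfolding B_def by auto
    show "\<Omega> - a \<in> B" if "a \<in> B" for a
    proof -
      obtain n where "a \<in> L n" using \<open>a \<in> B\<close> by (auto simp: B_def)
      then have "\<Omega> - a \<in> L (Suc n)" by (auto simp: LS step_def)
      then show ?thesis unfolding B_def by blast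
    qed
    show "a \<union> b \<in> B" if "a \<in> B" "b \<in> B" for a b
    proof -
      obtain m n where "a \<in> L m" "b \<in> L n" using \<open>a \<in> B\<close> \<open>b \<in> B\<close> by (auto simp: B_def)
      then have "a \<in> L (max m n)" "b \<in> L (max m n)" using inc by (meson max.cobounded1 max.cobounded2 subsetD)+
      then have "a \<union> b \<in> L (Suc (max m n))" by (force simp: LS step_def)
      then show ?thesis unfolding B_def by blast
    qed
  qed
  have "sigma_sets \<Omega> A = sigma_sets \<Omega> B"
  proof
    show "sigma_sets \<Omega> A \<subseteq> sigma_sets \<Omega> B"
      by (rule sigma_sets_mono') (use L0 in \<open>auto simp: B_def\<close>)
    show "sigma_sets \<Omega> B \<subseteq> sigma_sets \<Omega> A"
      by (rule sigma_sets_mono) (use sig in \<open>auto simp: B_def\<close>)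
  qed
  with cnt alg show thesis by (intro that[of B]) (auto simp: B_def)
qed

text \<open>Dynkin induction. A countable disjoint union is cut to finitely many members at cost e/2
  by continuity from below; the finite part is then approximated to within e/2, halving the
  tolerance with each member added.\<close>

lemma (in finite_measure) approximation_by_algebra:
  assumes sets: "sets M = sigma_sets (space M) B" and alg: "algebra (space M) B"
    and E: "E \<in> sets M" and "0 < (e::real)"
  shows "\<exists>A\<in>B. measure M (sym_diff E A) < e"
proof -
  interpret algebra "space M" B by (rule alg)
  have B_M[measurable]: "A \<in> B \<Longrightarrow> A \<in> sets M" for A unfolding sets by blast
  have "E \<in> sigma_sets (space M) B" using E sets by simp
  then show ?thesis using \<open>0 < e\<close>
  proof (induction arbitrary: e rule: sigma_sets_induct_disjoint[OF Int_stable space_closed, consumes 1, case_names basic empty compl union])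
    case (basic A)
    then show ?case by (intro bexI[of _ A]) auto
  next
    case empty
    then show ?case by (intro bexI[of _ "{}"]) auto
  next
    case (compl D)
    then obtain A where A: "A \<in> B" "measure M (sym_diff D A) < e" by blast
    have "D \<subseteq> space M" "A \<subseteq> space M"
      using compl(1) A(1) sets sets.sets_into_space space_closed by auto
    then have "sym_diff (space M - D) (space M - A) = sym_diff D A" by blast
    with A show ?case by (intro bexI[of _ "space M - A"]) auto
  next
    case (union D)
    have D[measurable]: "D i \<in> sets M" for i using union(2) sets by auto
    have "(\<lambda>n. measure M (\<Union>i<n. D i)) \<longlonglongrightarrow> measure M (\<Union>n. \<Union>i<n. D i)"
      by (intro finite_Lim_measure_incseq) (auto simp: incseq_def, force)
    moreover have "(\<Union>n. \<Union>i<n. D i) = (\<Union>i. D i)" by auto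
    ultimately have "\<forall>\<^sub>F n in sequentially. measure M (\<Union>i. D i) - e / 2 < measure M (\<Union>i<n. D i)"
      using \<open>0 < e\<close> by (intro order_tendstoD(1)) auto
    then obtain n where n: "measure M (\<Union>i. D i) - e / 2 < measure M (\<Union>i<n. D i)"
      by (auto simp: eventually_sequentially)
    have "\<exists>A\<in>B. measure M (sym_diff (\<Union>i<m. D i) A) < d" if "0 < d" for m and d :: real
      using that
    proof (induction m arbitrary: d)
      case 0 then show ?case by (intro bexI[of _ "{}"]) auto
    next
      case (Suc m)
      obtain A where A: "A \<in> B" "measure M (sym_diff (\<Union>i<m. D i) A) < d/2" using Suc.IH[of "d/2"] Suc.prems by auto
      obtain A' where A': "A' \<in> B" "measure M (sym_diff (D m) A') < d/2" using union.IH[of "d/2" m] Suc.prems by auto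
      have "measure M (sym_diff (\<Union>i<Suc m. D i) (A \<union> A'))
          \<le> measure M (sym_diff (\<Union>i<m. D i) A \<union> sym_diff (D m) A')"
        by (rule finite_measure_mono) (use A(1) A'(1) in \<open>auto simp: less_Suc_eq\<close>)
      also have "\<dots> \<le> measure M (sym_diff (\<Union>i<m. D i) A) + measure M (sym_diff (D m) A')"
        by (rule measure_Un_le) (use A(1) A'(1) in auto)
      finally show ?case using A A' by (intro bexI[of _ "A \<union> A'"]) auto
    qed
    then obtain A where A: "A \<in> B" "measure M (sym_diff (\<Union>i<n. D i) A) < e/2"
      using \<open>0 < e\<close> half_gt_zero by blast
    have "measure M (sym_diff (\<Union>i. D i) A)
        \<le> measure M (((\<Union>i. D i) - (\<Union>i<n. D i)) \<union> sym_diff (\<Union>i<n. D i) A)"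
      by (rule finite_measure_mono) (use A(1) in auto)
    also have "\<dots> \<le> measure M ((\<Union>i. D i) - (\<Union>i<n. D i)) + measure M (sym_diff (\<Union>i<n. D i) A)"
      by (rule measure_Un_le) (use A(1) in auto)
    also have "measure M ((\<Union>i. D i) - (\<Union>i<n. D i)) = measure M (\<Union>i. D i) - measure M (\<Union>i<n. D i)"
      by (rule finite_measure_Diff) auto
    finally show ?case using n A by (intro bexI[of _ A]) auto
  qed
qed

text \<open>An inequality between measures does not pass to complements, so Dynkin induction on the
  inequality itself would fail. Approximation of E by a member of the algebra replaces it.\<close>

lemma measure_le_of_generating_algebra:
  assumes fin: "finite_measure M" "finite_measure N"
    and sets: "sets M = sigma_sets (space M) B" "sets N = sets M"
    and alg: "algebra (space M) B"
    and le: "\<And>A. A \<in> B \<Longrightarrow> emeasure M A \<le> emeasure N A"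
    and E: "E \<in> sets M"
  shows "emeasure M E \<le> emeasure N E"
proof -
  interpret M: finite_measure M by fact
  interpret N: finite_measure N by fact
  have sp: "space N = space M" using sets(2) by (rule sets_eq_imp_space_eq)
  have B_M[measurable]: "A \<in> B \<Longrightarrow> A \<in> sets M" for A unfolding sets by blast
  \<comment> \<open>One set A must approximate E for both measures at once; approximating for their
    sum makes the two errors together less than e.\<close>
  define S where "S = measure_of (space M) (sets M) (\<lambda>A. emeasure M A + emeasure N A)"
  have S_sets[simp]: "sets S = sets M" "space S = space M" by (simp_all add: S_def)
  have em: "emeasure S A = emeasure M A + emeasure N A" if "A \<in> sets M" for A
  proof (rule emeasure_measure_of[OF S_def])
    show "countably_additive (sets S) (\<lambda>A. emeasure M A + emeasure N A)"
      unfolding countably_additive_def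
      by (auto simp: suminf_add[symmetric] suminf_emeasure sets(2))
  qed (use that sets.space_closed in \<open>auto simp: positive_def\<close>)
  interpret S: finite_measure S
    by (rule finite_measureI) (simp add: em M.emeasure_finite N.emeasure_finite)
  have "measure M E \<le> measure N E + e" if "0 < e" for e
  proof -
    obtain A where A: "A \<in> B" "measure S (sym_diff E A) < e"
      using S.approximation_by_algebra[of B E e] sets(1) alg E \<open>0 < e\<close> by auto
    have [measurable]: "E \<in> sets M" "A \<in> sets M" "E \<in> sets N" "A \<in> sets N"
      using E A(1) B_M sets(2) by auto
    have "measure M (sym_diff E A) + measure N (sym_diff E A) = measure S (sym_diff E A)"
      using em[of "sym_diff E A"]
      by (simp add: M.emeasure_eq_measure N.emeasure_eq_measure S.emeasure_eq_measure
          flip: ennreal_plus)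
    moreover have "measure M E \<le> measure M (A \<union> sym_diff E A)"
      by (rule M.finite_measure_mono) auto
    moreover have "\<dots> \<le> measure M A + measure M (sym_diff E A)"
      by (rule measure_Un_le) auto
    moreover have "measure N A \<le> measure N (E \<union> sym_diff E A)"
      by (rule N.finite_measure_mono) auto
    moreover have "\<dots> \<le> measure N E + measure N (sym_diff E A)"
      by (rule measure_Un_le) auto
    moreover have "measure M A \<le> measure N A"
      using le[OF A(1)] by (simp add: M.emeasure_eq_measure N.emeasure_eq_measure)
    ultimately show ?thesis using A(2) by linarith
  qed
  then have "measure M E \<le> measure N E" by (rule field_le_epsilon)
  then show ?thesis by (simp add: M.emeasure_eq_measure N.emeasure_eq_measure)
qed

section \<open>Disintegration along regular conditional probabilities\<close>

text \<open>Links \<open>regular_cond_prob\<close>, which speaks of real conditional expectations,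
  to the extended nonnegative integrals in which the disintegration is carried out.\<close>

lemma nn_cond_exp_indicator:
  assumes "prob_space M" "subalgebra M A" and E[measurable]: "E \<in> sets M"
  shows "AE \<omega> in M. nn_cond_exp M A (indicator E) \<omega> = ennreal (real_cond_exp M A (indicator E) \<omega>)"
proof -
  interpret prob_space M by fact
  interpret sigma_finite_subalgebra M A
    by (rule finite_measure_subalgebra_is_sigma_finite) (unfold_locales, rule assms)
  have pos: "AE \<omega> in M. 0 \<le> real_cond_exp M A (indicator E) \<omega>"
    by (rule real_cond_exp_pos) auto
  show ?thesis
  proof (rule AE_symmetric[OF nn_cond_exp_charact])
    fix D assume D: "D \<in> sets A"
    then have [measurable]: "D \<in> sets M" using assms(2) by (auto simp: subalgebra_def)
    have ind: "integrable M (indicator E :: 'a \<Rightarrow> real)"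
        by (simp add: integrable_indicator_iff emeasure_eq_measure)
    have "(\<integral>\<^sup>+\<omega>\<in>D. ennreal (real_cond_exp M A (indicator E) \<omega>) \<partial>M)
        = (\<integral>\<^sup>+\<omega>. ennreal (indicator D \<omega> * real_cond_exp M A (indicator E) \<omega>) \<partial>M)"
      by (intro nn_integral_cong) (auto simp: indicator_def)
    also have "\<dots> = ennreal (\<integral>\<omega>. indicator D \<omega> * real_cond_exp M A (indicator E) \<omega> \<partial>M)"
      by (rule nn_integral_eq_integral)
         (use pos integrable_mult_indicator[OF \<open>D \<in> sets M\<close> real_cond_exp_int(1)[OF ind]] in \<open>auto simp: indicator_def\<close>)
    also have "\<dots> = ennreal (\<integral>\<omega>. indicator D \<omega> * indicator E \<omega> \<partial>M)"
      using real_cond_exp_intA[OF ind D] by (simp add: set_lebesgue_integral_def)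
    also have "\<dots> = (\<integral>\<^sup>+\<omega>\<in>D. indicator E \<omega> \<partial>M)"
      by (simp add: emeasure_eq_measure Int_commute flip: indicator_inter_arith)
    finally show "(\<integral>\<^sup>+\<omega>\<in>D. indicator E \<omega> \<partial>M) = (\<integral>\<^sup>+\<omega>\<in>D. ennreal (real_cond_exp M A (indicator E) \<omega>) \<partial>M)" ..
  qed auto
qed

text \<open>For an indicator h this is the defining property of conditional expectation tested with
  g. The null set on which the kernel differs from it depends on the event but disappears under the
  outer integral; linearity and monotone limits give general h.\<close>

lemma nn_integral_kernel:
  assumes "prob_space M" "subalgebra M A" "subalgebra M B" and K: "regular_cond_prob M A B K"
    and g: "g \<in> borel_measurable A" and h: "h \<in> borel_measurable B"
  shows "(\<integral>\<^sup>+\<omega>. g \<omega> * h \<omega> \<partial>M) = (\<integral>\<^sup>+\<omega>. g \<omega> * (\<integral>\<^sup>+\<omega>'. h \<omega>' \<partial>K \<omega>) \<partial>M)"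
proof -
  interpret prob_space M by fact
  interpret sigma_finite_subalgebra M A
    by (rule finite_measure_subalgebra_is_sigma_finite) (unfold_locales, rule assms)
  have K_B: "K \<in> measurable A (prob_algebra B)" using K by (simp add: regular_cond_prob_def)
  then have K_sub[measurable]: "K \<in> measurable A (subprob_algebra B)" by (rule measurable_prob_algebraD)
  have sets_K: "sets (K \<omega>) = sets B" if "\<omega> \<in> space M" for \<omega>
    using sets_kernel[OF K_sub] that assms(2) by (simp add: subalgebra_def)
  have meas: "(\<lambda>\<omega>. \<integral>\<^sup>+\<omega>'. h \<omega>' \<partial>K \<omega>) \<in> borel_measurable M" if "h \<in> borel_measurable B" for h
    by (rule measurable_from_subalg[OF assms(2)]) (use that in measurable)
  have h_K: "h \<in> borel_measurable (K \<omega>)" if "h \<in> borel_measurable B" "\<omega> \<in> space M" for h :: "'a \<Rightarrow> ennreal" and \<omega>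
    using that sets_K measurable_cong_sets by blast
  note g_M[measurable] = measurable_from_subalg[OF assms(2) g]
  have indicator_kernel: "(\<integral>\<^sup>+\<omega>. g \<omega> * indicator E \<omega> \<partial>M) = (\<integral>\<^sup>+\<omega>. g \<omega> * emeasure (K \<omega>) E \<partial>M)"
    if E[measurable]: "E \<in> sets B" for E
  proof -
    have E_M[measurable]: "E \<in> sets M" using assms(3) E by (auto simp: subalgebra_def)
    have prob_K: "prob_space (K \<omega>)" if "\<omega> \<in> space M" for \<omega>
      using measurable_space[OF K_B, of \<omega>] that assms(2) by (simp add: space_prob_algebra subalgebra_def)
    have "AE \<omega> in M. measure (K \<omega>) E = real_cond_exp M A (indicator E) \<omega>"
      using K E by (simp add: regular_cond_prob_def)
    moreover have "AE \<omega> in M. nn_cond_exp M A (indicator E) \<omega> = ennreal (real_cond_exp M A (indicator E) \<omega>)"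
      by (rule nn_cond_exp_indicator[OF \<open>prob_space M\<close> assms(2) E_M])
    ultimately have "AE \<omega> in M. emeasure (K \<omega>) E = nn_cond_exp M A (indicator E) \<omega>"
      using AE_space
    proof eventually_elim
      case (elim \<omega>)
      interpret K: prob_space "K \<omega>" by (rule prob_K) (rule elim)
      show ?case using elim by (simp add: K.emeasure_eq_measure)
    qed
    then have "(\<integral>\<^sup>+\<omega>. g \<omega> * emeasure (K \<omega>) E \<partial>M) = (\<integral>\<^sup>+\<omega>. g \<omega> * nn_cond_exp M A (indicator E) \<omega> \<partial>M)"
      by (intro nn_integral_cong_AE) auto
    also have "\<dots> = (\<integral>\<^sup>+\<omega>. g \<omega> * indicator E \<omega> \<partial>M)"
      by (rule nn_cond_exp_intg[OF g]) simp
    finally show ?thesis ..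
  qed
  have h_M: "h \<in> borel_measurable M" if "h \<in> borel_measurable B" for h :: "'a \<Rightarrow> ennreal"
    by (rule measurable_from_subalg[OF assms(3) that])
  from h show ?thesis
  proof (induction rule: borel_measurable_induct)
    case (cong f h)
    have "(\<integral>\<^sup>+\<omega>'. f \<omega>' \<partial>K \<omega>) = (\<integral>\<^sup>+\<omega>'. h \<omega>' \<partial>K \<omega>)" if "\<omega> \<in> space M" for \<omega>
      by (rule nn_integral_cong) (use cong(3) sets_eq_imp_space_eq[OF sets_K[OF that]] in auto)
    moreover have "f \<omega> = h \<omega>" if "\<omega> \<in> space M" for \<omega>
      using cong(3) that assms(3) by (simp add: subalgebra_def)
    ultimately show ?case using cong(4) by (simp cong: nn_integral_cong)
  next
    case (set E)
    with sets_K show ?case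
      by (subst indicator_kernel[OF set]) (auto intro!: nn_integral_cong)
  next
    case (mult h c)
    note [measurable] = h_M[OF mult(2)] meas[OF mult(2)]
    have "(\<integral>\<^sup>+\<omega>. g \<omega> * (\<integral>\<^sup>+\<omega>'. c * h \<omega>' \<partial>K \<omega>) \<partial>M) = (\<integral>\<^sup>+\<omega>. c * (g \<omega> * (\<integral>\<^sup>+\<omega>'. h \<omega>' \<partial>K \<omega>)) \<partial>M)"
      by (intro nn_integral_cong) (simp add: nn_integral_cmult h_K[OF mult(2)] ac_simps)
    also have "\<dots> = c * (\<integral>\<^sup>+\<omega>. g \<omega> * h \<omega> \<partial>M)"
      by (subst nn_integral_cmult) (auto simp: mult.IH)
    also have "\<dots> = (\<integral>\<^sup>+\<omega>. g \<omega> * (c * h \<omega>) \<partial>M)"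
      by (subst nn_integral_cmult[symmetric]) (auto simp: ac_simps)
    finally show ?case ..
  next
    case (add h h')
    note [measurable] = h_M[OF add(1)] meas[OF add(1)] h_M[OF add(3)] meas[OF add(3)]
    have "(\<integral>\<^sup>+\<omega>. g \<omega> * (\<integral>\<^sup>+\<omega>'. h' \<omega>' + h \<omega>' \<partial>K \<omega>) \<partial>M)
        = (\<integral>\<^sup>+\<omega>. g \<omega> * (\<integral>\<^sup>+\<omega>'. h' \<omega>' \<partial>K \<omega>) + g \<omega> * (\<integral>\<^sup>+\<omega>'. h \<omega>' \<partial>K \<omega>) \<partial>M)"
      by (intro nn_integral_cong) (simp add: nn_integral_add h_K[OF add(1)] h_K[OF add(3)] distrib_left)
    also have "\<dots> = (\<integral>\<^sup>+\<omega>. g \<omega> * h' \<omega> \<partial>M) + (\<integral>\<^sup>+\<omega>. g \<omega> * h \<omega> \<partial>M)"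
      by (subst nn_integral_add) (auto simp: add.IH)
    also have "\<dots> = (\<integral>\<^sup>+\<omega>. g \<omega> * (h' \<omega> + h \<omega>) \<partial>M)"
      by (subst nn_integral_add[symmetric]) (auto simp: distrib_left)
    finally show ?case ..
  next
    case (seq U)
    note [measurable] = h_M[OF seq(1)] meas[OF seq(1)]
    have inc: "incseq (\<lambda>i \<omega>. \<integral>\<^sup>+\<omega>'. U i \<omega>' \<partial>K \<omega>)"
      using seq(3) by (auto simp: incseq_def le_fun_def intro!: nn_integral_mono)
    have "(\<integral>\<^sup>+\<omega>. g \<omega> * (\<integral>\<^sup>+\<omega>'. (SUP i. U i) \<omega>' \<partial>K \<omega>) \<partial>M)
        = (\<integral>\<^sup>+\<omega>. (SUP i. g \<omega> * (\<integral>\<^sup>+\<omega>'. U i \<omega>' \<partial>K \<omega>)) \<partial>M)"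
      by (intro nn_integral_cong)
         (simp add: nn_integral_monotone_convergence_SUP[OF seq(3)] h_K[OF seq(1)] SUP_mult_left_ennreal image_comp)
    also have "\<dots> = (SUP i. \<integral>\<^sup>+\<omega>. g \<omega> * (\<integral>\<^sup>+\<omega>'. U i \<omega>' \<partial>K \<omega>) \<partial>M)"
      by (rule nn_integral_monotone_convergence_SUP)
         (use inc in \<open>auto simp: incseq_def le_fun_def intro!: mult_left_mono\<close>)
    also have "\<dots> = (SUP i. \<integral>\<^sup>+\<omega>. g \<omega> * U i \<omega> \<partial>M)" by (simp add: seq.IH)
    also have "\<dots> = (\<integral>\<^sup>+\<omega>. (SUP i. g \<omega> * U i \<omega>) \<partial>M)"
      by (rule nn_integral_monotone_convergence_SUP[symmetric])
         (use seq(3) in \<open>auto simp: incseq_def le_fun_def intro!: mult_left_mono\<close>)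
    also have "\<dots> = (\<integral>\<^sup>+\<omega>. g \<omega> * (SUP i. U i) \<omega> \<partial>M)"
      by (simp add: SUP_mult_left_ennreal image_comp)
    finally show ?case ..
  qed
qed

section \<open>Universal supermartingale densities\<close>

text \<open>Testing on the single set where the inequality fails is enough. There g lies below f, so
  both integrals are finite and may be subtracted.\<close>

lemma AE_le_of_nn_integral_le:
  fixes f g :: "'a \<Rightarrow> ennreal"
  assumes [measurable]: "f \<in> borel_measurable M" "g \<in> borel_measurable M"
    and fin: "integral\<^sup>N M f \<noteq> \<infinity>"
    and le: "(\<integral>\<^sup>+\<omega>. indicator {\<omega>\<in>space M. g \<omega> < f \<omega>} \<omega> * f \<omega> \<partial>M)
      \<le> (\<integral>\<^sup>+\<omega>. indicator {\<omega>\<in>space M. g \<omega> < f \<omega>} \<omega> * g \<omega> \<partial>M)"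
  shows "AE \<omega> in M. f \<omega> \<le> g \<omega>"
proof -
  let ?I = "indicator {\<omega>\<in>space M. g \<omega> < f \<omega>} :: 'a \<Rightarrow> ennreal"
  have "(\<integral>\<^sup>+\<omega>. ?I \<omega> * f \<omega> \<partial>M) \<le> integral\<^sup>N M f"
    by (intro nn_integral_mono) (auto simp: indicator_def)
  then have f_fin: "(\<integral>\<^sup>+\<omega>. ?I \<omega> * f \<omega> \<partial>M) < top"
    using fin by (auto simp: top_unique less_top)
  have "(\<integral>\<^sup>+\<omega>. ?I \<omega> * g \<omega> \<partial>M) \<le> integral\<^sup>N M f"
    by (intro nn_integral_mono) (auto simp: indicator_def)
  then have "(\<integral>\<^sup>+\<omega>. ?I \<omega> * g \<omega> \<partial>M) \<noteq> \<infinity>" using fin by (auto simp: top_unique)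
  then have "(\<integral>\<^sup>+\<omega>. ?I \<omega> * f \<omega> - ?I \<omega> * g \<omega> \<partial>M)
      = (\<integral>\<^sup>+\<omega>. ?I \<omega> * f \<omega> \<partial>M) - (\<integral>\<^sup>+\<omega>. ?I \<omega> * g \<omega> \<partial>M)"
    by (intro nn_integral_diff) (auto simp: indicator_def)
  also have "\<dots> = 0" using f_fin le by (rule diff_eq_0_ennreal)
  finally have "AE \<omega> in M. ?I \<omega> * f \<omega> - ?I \<omega> * g \<omega> = 0"
    by (subst (asm) nn_integral_0_iff_AE) auto
  then show ?thesis using AE_space
  proof eventually_elim
    case (elim \<omega>)
    then show ?case by (cases "g \<omega> < f \<omega>") (auto simp: diff_eq_0_iff_ennreal)
  qed
qed

section \<open>Integrability and positivity of the density, also under the kernels\<close>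

lemma (in prob_space) supermartingale_const:
  assumes "filtration_of M F"
  shows "supermartingale M F (\<lambda>_ _. c)"
proof -
  have "AE \<omega> in M. real_cond_exp M (F s) (\<lambda>_. c) \<omega> \<le> c" if "0 \<le> s" for s
  proof -
    interpret sigma_finite_subalgebra M "F s"
      by (rule sigma_finite_subalgebra_if_subalgebra)
         (use assms that in \<open>simp add: filtration_of_def\<close>)
    show ?thesis by (rule real_cond_exp_le_c) auto
  qed
  moreover have "cadlag (\<lambda>_. c)" by (auto simp: cadlag_def)
  ultimately show ?thesis by (auto simp: supermartingale_def adapted_to_def as_cadlag_def)
qed

lemma (in prob_space) nn_integral_supermartingale_le:
  assumes S: "supermartingale M G S" and sub: "subalgebra M (G t)"
    and "0 \<le> t" "t \<le> u" and A: "A \<in> sets (G t)"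
    and pos: "AE \<omega> in M. 0 \<le> S t \<omega>" "AE \<omega> in M. 0 \<le> S u \<omega>"
  shows "(\<integral>\<^sup>+\<omega>. ennreal (S u \<omega>) * indicator A \<omega> \<partial>M) \<le> (\<integral>\<^sup>+\<omega>. ennreal (S t \<omega>) * indicator A \<omega> \<partial>M)"
proof -
  interpret sigma_finite_subalgebra M "G t"
    by (rule sigma_finite_subalgebra_if_subalgebra[OF sub])
  have int: "integrable M (S t)" "integrable M (S u)"
    and le: "AE \<omega> in M. real_cond_exp M (G t) (S u) \<omega> \<le> S t \<omega>"
    using S \<open>0 \<le> t\<close> \<open>t \<le> u\<close> by (auto simp: supermartingale_def)
  have A_M[measurable]: "A \<in> sets M" using A sub by (auto simp: subalgebra_def)
  have eq: "(\<integral>\<^sup>+\<omega>. ennreal (S r \<omega>) * indicator A \<omega> \<partial>M) = ennreal (\<integral>\<omega>\<in>A. S r \<omega> \<partial>M)"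
    if "integrable M (S r)" "AE \<omega> in M. 0 \<le> S r \<omega>" for r
  proof -
    have "(\<integral>\<^sup>+\<omega>. ennreal (S r \<omega>) * indicator A \<omega> \<partial>M) = (\<integral>\<^sup>+\<omega>. ennreal (indicator A \<omega> * S r \<omega>) \<partial>M)"
      by (intro nn_integral_cong) (auto simp: indicator_def)
    also have "\<dots> = ennreal (\<integral>\<omega>. indicator A \<omega> * S r \<omega> \<partial>M)"
      by (rule nn_integral_eq_integral)
         (use that integrable_mult_indicator[OF A_M that(1)] in \<open>auto simp: indicator_def\<close>)
    finally show ?thesis by (simp add: set_lebesgue_integral_def)
  qed
  have "(\<integral>\<omega>\<in>A. S u \<omega> \<partial>M) = (\<integral>\<omega>\<in>A. real_cond_exp M (G t) (S u) \<omega> \<partial>M)"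
    by (rule real_cond_exp_intA[OF int(2) A])
  also have "\<dots> \<le> (\<integral>\<omega>\<in>A. S t \<omega> \<partial>M)"
    unfolding set_lebesgue_integral_def
  proof (rule integral_mono_AE)
    show "AE \<omega> in M. indicator A \<omega> *\<^sub>R real_cond_exp M (G t) (S u) \<omega> \<le> indicator A \<omega> *\<^sub>R S t \<omega>"
      using le by eventually_elim (simp add: mult_left_mono)
  qed (intro integrable_mult_indicator A_M int real_cond_exp_int)+
  finally show ?thesis using eq int pos by (simp add: ennreal_leI)
qed

text \<open>Integrability comes from testing the density against the constant supermartingale 1,
  which makes \<open>Z\<close> itself a supermartingale.\<close>

lemma integrable_universal_density:
  assumes "prob_space M" "filtration_of M F"
    and Z: "universal_supermartingale_density M F G Z" and "0 \<le> r"
  shows "integrable M (Z r)"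
proof -
  interpret prob_space M by fact
  have "supermartingale M G (\<lambda>t \<omega>. Z t \<omega> * 1)"
    using Z supermartingale_const[OF \<open>filtration_of M F\<close>, of 1]
    unfolding universal_supermartingale_density_def by fastforce
  then show ?thesis using \<open>0 \<le> r\<close> by (simp add: supermartingale_def)
qed

lemma AE_universal_density_pos:
  assumes "prob_space M" and Z: "universal_supermartingale_density M F G Z" and "0 \<le> r"
  shows "AE \<omega> in M. 0 < Z r \<omega>"
proof -
  interpret prob_space M by fact
  have prob1: "prob {\<omega> \<in> space M. 0 < Z r \<omega>} = 1"
    using Z \<open>0 \<le> r\<close> by (auto simp: universal_supermartingale_density_def)
  \<comment> \<open>A set outside the sigma-algebra has \<open>measure\<close> 0 by convention, so
    the value 1 certifies measurability.\<close>
  then have "{\<omega> \<in> space M. 0 < Z r \<omega>} \<in> events"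
    by (metis measure_notin_sets zero_neq_one)
  with prob1 show ?thesis using AE_in_set_eq_1 by fastforce
qed

text \<open>The mean over outcomes of these total masses is the mean of the positive part of
  \<open>Z r\<close>. Finite mass is what the comparison on a generating algebra will ask
  for.\<close>

lemma AE_density_kernel_finite:
  assumes "prob_space M" "filtration_of M F" "filtration_of M G"
    and K: "\<And>t. 0 \<le> t \<Longrightarrow> regular_cond_prob M (F t) (G t) (K t)"
    and Z: "universal_supermartingale_density M F G Z" and "0 \<le> r"
  shows "AE \<omega> in M. (\<integral>\<^sup>+\<omega>'. ennreal (Z r \<omega>') * indicator (space M) \<omega>' \<partial>K r \<omega>) \<noteq> \<infinity>"
proof -
  have sub: "subalgebra M (F r)" "subalgebra M (G r)"
    using assms(2,3) \<open>0 \<le> r\<close> by (auto simp: filtration_of_def)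
  have Z_G[measurable]: "Z r \<in> borel_measurable (G r)"
    using Z \<open>0 \<le> r\<close> by (auto simp: universal_supermartingale_density_def adapted_to_def)
  have [measurable]: "space M \<in> sets (G r)"
    using sub(2) sets.top[of "G r"] by (simp add: subalgebra_def)
  have K_sub[measurable]: "K r \<in> measurable (F r) (subprob_algebra (G r))"
    using K[OF \<open>0 \<le> r\<close>] by (simp add: regular_cond_prob_def measurable_prob_algebraD)
  have "(\<integral>\<^sup>+\<omega>. 1 * (\<integral>\<^sup>+\<omega>'. ennreal (Z r \<omega>') * indicator (space M) \<omega>' \<partial>K r \<omega>) \<partial>M)
      = (\<integral>\<^sup>+\<omega>. 1 * (ennreal (Z r \<omega>) * indicator (space M) \<omega>) \<partial>M)"
    by (rule nn_integral_kernel[OF \<open>prob_space M\<close> sub K[OF \<open>0 \<le> r\<close>], symmetric]) auto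
  also have "\<dots> \<le> (\<integral>\<^sup>+\<omega>. ennreal (norm (Z r \<omega>)) \<partial>M)"
    by (intro nn_integral_mono) (auto simp: indicator_def intro: ennreal_leI)
  also have "\<dots> < \<infinity>"
    using integrable_universal_density[OF assms(1,2) Z \<open>0 \<le> r\<close>] by (simp add: integrable_iff_bounded)
  finally have "(\<integral>\<^sup>+\<omega>. (\<integral>\<^sup>+\<omega>'. ennreal (Z r \<omega>') * indicator (space M) \<omega>' \<partial>K r \<omega>) \<partial>M) \<noteq> \<infinity>"
    by simp
  moreover have "(\<lambda>\<omega>. \<integral>\<^sup>+\<omega>'. ennreal (Z r \<omega>') * indicator (space M) \<omega>' \<partial>K r \<omega>) \<in> borel_measurable M"
    by (rule measurable_from_subalg[OF sub(1)]) measurable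
  ultimately show ?thesis by (intro nn_integral_PInf_AE)
qed

text \<open>A null set of M has conditional probability 0 at almost every outcome. This transfers
  positivity from M to the individual kernels, which may be singular to M.\<close>

lemma AE_kernel_density_pos:
  assumes "prob_space M" "filtration_of M F" "filtration_of M G"
    and K: "\<And>t. 0 \<le> t \<Longrightarrow> regular_cond_prob M (F t) (G t) (K t)"
    and Z: "universal_supermartingale_density M F G Z" and "0 \<le> r"
  shows "AE \<omega> in M. AE \<omega>' in K r \<omega>. 0 < Z r \<omega>'"
proof -
  have sub: "subalgebra M (F r)" "subalgebra M (G r)"
    using assms(2,3) \<open>0 \<le> r\<close> by (auto simp: filtration_of_def)
  have Z_G[measurable]: "Z r \<in> borel_measurable (G r)"
    using Z \<open>0 \<le> r\<close> by (auto simp: universal_supermartingale_density_def adapted_to_def)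
  have K_sub[measurable]: "K r \<in> measurable (F r) (subprob_algebra (G r))"
    using K[OF \<open>0 \<le> r\<close>] by (simp add: regular_cond_prob_def measurable_prob_algebraD)
  define N where "N = {\<omega>\<in>space (G r). Z r \<omega> \<le> 0}"
  have N[measurable]: "N \<in> sets (G r)" unfolding N_def by measurable
  have "(\<integral>\<^sup>+\<omega>. 1 * (\<integral>\<^sup>+\<omega>'. indicator N \<omega>' \<partial>K r \<omega>) \<partial>M) = (\<integral>\<^sup>+\<omega>. 1 * indicator N \<omega> \<partial>M)"
    by (rule nn_integral_kernel[OF \<open>prob_space M\<close> sub K[OF \<open>0 \<le> r\<close>], symmetric]) auto
  also have "\<dots> = (\<integral>\<^sup>+\<omega>. 0 \<partial>M)"
    by (rule nn_integral_cong_AE)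
       (use AE_universal_density_pos[OF assms(1) Z \<open>0 \<le> r\<close>] in \<open>eventually_elim, simp add: N_def indicator_def\<close>)
  finally have zero: "(\<integral>\<^sup>+\<omega>. (\<integral>\<^sup>+\<omega>'. indicator N \<omega>' \<partial>K r \<omega>) \<partial>M) = 0" by simp
  have "(\<lambda>\<omega>. \<integral>\<^sup>+\<omega>'. indicator N \<omega>' \<partial>K r \<omega>) \<in> borel_measurable M"
    by (rule measurable_from_subalg[OF sub(1)]) measurable
  from nn_integral_0_iff_AE[OF this] zero
  have "AE \<omega> in M. (\<integral>\<^sup>+\<omega>'. indicator N \<omega>' \<partial>K r \<omega>) = 0" by simp
  then show ?thesis using AE_space
  proof eventually_elim
    case (elim \<omega>)
    have sets_K: "sets (K r \<omega>) = sets (G r)"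
      using sets_kernel[OF K_sub] elim(2) sub(1) by (simp add: subalgebra_def)
    have "N \<in> null_sets (K r \<omega>)"
      using elim(1) N by (intro null_setsI) (simp_all add: sets_K)
    then show ?case
      by (rule AE_I') (auto simp: N_def sets_eq_imp_space_eq[OF sets_K])
  qed
qed

text \<open>For B in \<open>F u\<close>, the martingale of B equals its indicator at u and its
  conditional probability at t. The right-hand kernel integral is \<open>F t\<close>-measurable, so
  in its product with that conditional probability the indicator of B can be put back under the
  integral. Both sides then carry the same weight.\<close>

lemma density_kernel_le:
  assumes "prob_space M" and F: "filtration_of M F" "right_continuous_filtration F"
    and G: "filtration_of M G"
    and K: "\<And>t. 0 \<le> t \<Longrightarrow> regular_cond_prob M (F t) (G t) (K t)"
    and Z: "universal_supermartingale_density M F G Z"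
    and tu: "0 \<le> t" "t \<le> u" and A: "A \<in> sets (G t)"
  shows "AE \<omega> in M. (\<integral>\<^sup>+\<omega>'. ennreal (Z u \<omega>') * indicator A \<omega>' \<partial>K u \<omega>)
    \<le> (\<integral>\<^sup>+\<omega>'. ennreal (Z t \<omega>') * indicator A \<omega>' \<partial>K t \<omega>)" (is "AE \<omega> in M. ?l \<omega> \<le> ?n \<omega>")
proof -
  interpret prob_space M by fact
  note fil = F(1)[unfolded filtration_of_def] G[unfolded filtration_of_def]
  have "0 \<le> u" using tu by simp
  have subF: "subalgebra M (F t)" "subalgebra M (F u)" "subalgebra (F u) (F t)"
    and subG: "subalgebra M (G t)" "subalgebra M (G u)" "subalgebra (G u) (G t)"
    using fil tu \<open>0 \<le> u\<close> by auto
  have A_u[measurable]: "A \<in> sets (G u)" "A \<in> sets M"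
    using A subG by (auto simp: subalgebra_def)
  have adapt: "Z t \<in> borel_measurable (G t)" "Z u \<in> borel_measurable (G u)"
    and super: "\<And>X. supermartingale M F X \<Longrightarrow> (\<And>t \<omega>. 0 \<le> X t \<omega>) \<Longrightarrow> supermartingale M G (\<lambda>t \<omega>. Z t \<omega> * X t \<omega>)"
    using Z tu \<open>0 \<le> u\<close> by (auto simp: universal_supermartingale_density_def adapted_to_def)
  note [measurable] = adapt measurable_from_subalg[OF subG(1) adapt(1)] measurable_from_subalg[OF subG(2) adapt(2)]
  note pos = AE_universal_density_pos[OF assms(1) Z]
  have K_sub: "K r \<in> measurable (F r) (subprob_algebra (G r))" if "0 \<le> r" for r
    using K[OF that] by (simp add: regular_cond_prob_def measurable_prob_algebraD)
  have l_F: "?l \<in> borel_measurable (F u)" and n_F: "?n \<in> borel_measurable (F t)"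
    using K_sub[OF \<open>0 \<le> u\<close>] K_sub[OF tu(1)] A A_u(1) adapt by measurable
  note n_Fu = measurable_from_subalg[OF subF(3) n_F]
  have l_M[measurable]: "?l \<in> borel_measurable M" and n_M[measurable]: "?n \<in> borel_measurable M"
    using measurable_from_subalg[OF subF(2) l_F] measurable_from_subalg[OF subF(1) n_F] by auto
  have int_l: "(\<integral>\<^sup>+\<omega>. g \<omega> * (ennreal (Z u \<omega>) * indicator A \<omega>) \<partial>M) = (\<integral>\<^sup>+\<omega>. g \<omega> * ?l \<omega> \<partial>M)"
    if "g \<in> borel_measurable (F u)" for g
    using that by (intro nn_integral_kernel[OF \<open>prob_space M\<close> subF(2) subG(2) K[OF \<open>0 \<le> u\<close>]]) auto
  have int_n: "(\<integral>\<^sup>+\<omega>. g \<omega> * (ennreal (Z t \<omega>) * indicator A \<omega>) \<partial>M) = (\<integral>\<^sup>+\<omega>. g \<omega> * ?n \<omega> \<partial>M)"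
    if "g \<in> borel_measurable (F t)" for g
    using that A by (intro nn_integral_kernel[OF \<open>prob_space M\<close> subF(1) subG(1) K[OF tu(1)]]) auto
  have main: "(\<integral>\<^sup>+\<omega>. indicator B \<omega> * ?l \<omega> \<partial>M) \<le> (\<integral>\<^sup>+\<omega>. indicator B \<omega> * ?n \<omega> \<partial>M)"
    if B: "B \<in> sets (F u)" for B
  proof -
    have B_M[measurable]: "B \<in> sets M" using B subF(2) by (auto simp: subalgebra_def)
    obtain X where X: "supermartingale M F X" "\<And>t \<omega>. 0 \<le> X t \<omega>"
      "\<And>t. 0 \<le> t \<Longrightarrow> AE \<omega> in M. real_cond_exp M (F t) (indicator B) \<omega> = X t \<omega>"
      by (rule cadlag_martingale_version[OF F(1) F(2), of "indicator B"]) (auto simp: indicator_def)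
    have X_F: "X t \<in> borel_measurable (F t)"
      using X(1) tu by (simp add: supermartingale_def adapted_to_def)
    interpret Fu: sigma_finite_subalgebra M "F u" by (rule sigma_finite_subalgebra_if_subalgebra[OF subF(2)])
    interpret Ft: sigma_finite_subalgebra M "F t" by (rule sigma_finite_subalgebra_if_subalgebra[OF subF(1)])
    have "AE \<omega> in M. real_cond_exp M (F u) (indicator B) \<omega> = indicator B \<omega>"
      by (rule Fu.real_cond_exp_F_meas)
         (use B in \<open>auto simp: integrable_indicator_iff emeasure_eq_measure\<close>)
    with X(3)[OF \<open>0 \<le> u\<close>] have X_u: "AE \<omega> in M. X u \<omega> = indicator B \<omega>" by eventually_elim simp
    have X_t: "AE \<omega> in M. nn_cond_exp M (F t) (indicator B) \<omega> = ennreal (X t \<omega>)"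
      using X(3)[OF tu(1)] nn_cond_exp_indicator[OF \<open>prob_space M\<close> subF(1) B_M] by eventually_elim simp
    have "(\<integral>\<^sup>+\<omega>. indicator B \<omega> * ?l \<omega> \<partial>M) = (\<integral>\<^sup>+\<omega>. indicator B \<omega> * (ennreal (Z u \<omega>) * indicator A \<omega>) \<partial>M)"
      by (rule int_l[symmetric]) (use B in auto)
    also have "\<dots> = (\<integral>\<^sup>+\<omega>. ennreal (Z u \<omega> * X u \<omega>) * indicator A \<omega> \<partial>M)"
      by (rule nn_integral_cong_AE) (use X_u in \<open>eventually_elim, auto simp: indicator_def\<close>)
    also have "\<dots> \<le> (\<integral>\<^sup>+\<omega>. ennreal (Z t \<omega> * X t \<omega>) * indicator A \<omega> \<partial>M)"
      by (rule nn_integral_supermartingale_le[OF super[OF X(1,2)] subG(1) tu A])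
         (use pos[OF tu(1)] pos[OF \<open>0 \<le> u\<close>] in \<open>eventually_elim, simp add: X(2)\<close>)+
    also have "\<dots> = (\<integral>\<^sup>+\<omega>. ennreal (X t \<omega>) * (ennreal (Z t \<omega>) * indicator A \<omega>) \<partial>M)"
      by (intro nn_integral_cong) (simp add: ennreal_mult' X(2) ac_simps)
    also have "\<dots> = (\<integral>\<^sup>+\<omega>. ennreal (X t \<omega>) * ?n \<omega> \<partial>M)"
      by (rule int_n) (use X_F in measurable)
    also have "\<dots> = (\<integral>\<^sup>+\<omega>. ?n \<omega> * nn_cond_exp M (F t) (indicator B) \<omega> \<partial>M)"
      by (rule nn_integral_cong_AE) (use X_t in \<open>eventually_elim, simp add: mult.commute\<close>)
    also have "\<dots> = (\<integral>\<^sup>+\<omega>. ?n \<omega> * indicator B \<omega> \<partial>M)"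
      by (rule Ft.nn_cond_exp_intg[OF n_F]) simp
    finally show ?thesis by (simp add: mult.commute)
  qed
  show ?thesis
  proof (rule AE_le_of_nn_integral_le)
    have "integrable M (Z u)"
      by (rule integrable_universal_density[OF assms(1) F(1) Z \<open>0 \<le> u\<close>])
    then have "(\<integral>\<^sup>+\<omega>. ennreal (norm (Z u \<omega>)) \<partial>M) < \<infinity>" by (simp add: integrable_iff_bounded)
    moreover have "integral\<^sup>N M ?l = (\<integral>\<^sup>+\<omega>. 1 * (ennreal (Z u \<omega>) * indicator A \<omega>) \<partial>M)"
      by (subst int_l) auto
    moreover have "\<dots> \<le> (\<integral>\<^sup>+\<omega>. ennreal (norm (Z u \<omega>)) \<partial>M)"
      by (intro nn_integral_mono) (auto simp: indicator_def intro: ennreal_leI)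
    ultimately show "integral\<^sup>N M ?l \<noteq> \<infinity>" by auto
    \<comment> \<open>The exceptional set may serve as B because both kernel integrals are
      \<open>F u\<close>-measurable.\<close>
    have "{\<omega> \<in> space M. ?n \<omega> < ?l \<omega>} = {\<omega> \<in> space (F u). ?n \<omega> < ?l \<omega>}"
      using subF(2) by (simp add: subalgebra_def)
    also have "\<dots> \<in> sets (F u)" using l_F n_Fu by measurable
    finally show "(\<integral>\<^sup>+\<omega>. indicator {\<omega> \<in> space M. ?n \<omega> < ?l \<omega>} \<omega> * ?l \<omega> \<partial>M)
      \<le> (\<integral>\<^sup>+\<omega>. indicator {\<omega> \<in> space M. ?n \<omega> < ?l \<omega>} \<omega> * ?n \<omega> \<partial>M)" by (rule main)
  qed simp_all
qed

section \<open>From domination of the weighted kernels to absolute continuity\<close>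

theorem proposition5p5:
  fixes M :: "'a measure"
    and F G :: "real \<Rightarrow> 'a measure"
    and K :: "real \<Rightarrow> 'a \<Rightarrow> 'a measure"
  assumes "prob_space M"
    and "filtration_of M F"
    and "right_continuous_filtration F"
    and "filtration_of M G"
    and "\<And>t. 0 \<le> t \<Longrightarrow> sets (F t) \<subseteq> sets (G t)"
    and "\<And>t. 0 \<le> t \<Longrightarrow> countably_generated (G t)"
    and "\<And>t. 0 \<le> t \<Longrightarrow> regular_cond_prob M (F t) (G t) (K t)"
    and "\<exists>Z. universal_supermartingale_density M F G Z"
  shows "generalized_jacod M G K"
  unfolding generalized_jacod_def
proof (intro allI impI)
  fix t s :: real assume "0 \<le> t" "0 \<le> s"
  define u where "u = t + s"
  have tu: "0 \<le> t" "t \<le> u" "0 \<le> u" using \<open>0 \<le> t\<close> \<open>0 \<le> s\<close> by (auto simp: u_def)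
  interpret prob_space M by fact
  from assms(8) obtain Z where Z: "universal_supermartingale_density M F G Z" ..
  have subF: "subalgebra M (F r)" and subG: "subalgebra M (G r)" if "0 \<le> r" for r
    using assms(2,4) that by (auto simp: filtration_of_def)
  have subG': "subalgebra (G u) (G t)"
    using assms(4) tu by (auto simp: filtration_of_def)
  have Z_G: "Z r \<in> borel_measurable (G r)" if "0 \<le> r" for r
    using Z that by (auto simp: universal_supermartingale_density_def adapted_to_def)
  have K_prob: "prob_space (K r \<omega>)" and K_sets: "sets (K r \<omega>) = sets (G r)" and K_space: "space (K r \<omega>) = space M"
    if "0 \<le> r" "\<omega> \<in> space M" for r \<omega>
  proof -
    have "K r \<omega> \<in> space (prob_algebra (G r))"
      using assms(7)[OF that(1)] subF[OF that(1)] that(2)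
      by (intro measurable_space[of "K r" "F r"]) (auto simp: regular_cond_prob_def subalgebra_def)
    then show "prob_space (K r \<omega>)" and sets: "sets (K r \<omega>) = sets (G r)"
      by (auto simp: space_prob_algebra)
    show "space (K r \<omega>) = space M"
      using sets_eq_imp_space_eq[OF sets] subG[OF that(1)] by (simp add: subalgebra_def)
  qed
  have space_G: "space (G t) = space M" using subG[OF tu(1)] by (simp add: subalgebra_def)
  obtain C where C: "countable C" "C \<subseteq> Pow (space M)" "sets (G t) = sigma_sets (space M) C"
    using assms(6)[OF tu(1)] space_G unfolding countably_generated_def by auto
  obtain B where B: "countable B" "algebra (space M) B" "sets (G t) = sigma_sets (space M) B"
    using countable_generating_algebra[OF C(1,2)] C(3) by metis
  define d where "d r A \<omega> = (\<integral>\<^sup>+\<omega>'. ennreal (Z r \<omega>') * indicator A \<omega>' \<partial>K r \<omega>)" for r A \<omega>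
  have "AE \<omega> in M. d u A \<omega> \<le> d t A \<omega>" if "A \<in> B" for A
    unfolding d_def
    by (rule density_kernel_le[OF assms(1-4,7) Z tu(1,2)]) (use that B(3) in auto)
  then have le: "AE \<omega> in M. \<forall>A\<in>B. d u A \<omega> \<le> d t A \<omega>"
    using B(1) by (simp add: AE_ball_countable)
  have fin: "AE \<omega> in M. d r (space M) \<omega> \<noteq> \<infinity>" if "0 \<le> r" for r
    unfolding d_def by (rule AE_density_kernel_finite[OF assms(1,2,4,7) Z that])
  have pos: "AE \<omega> in M. AE \<omega>' in K r \<omega>. 0 < Z r \<omega>'" if "0 \<le> r" for r
    by (rule AE_kernel_density_pos[OF assms(1,2,4,7) Z that])
  show "AE \<omega> in M. absolutely_continuous (K t \<omega>) (restr_to_subalg (K (t + s) \<omega>) (G t))"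
    using le fin[OF tu(1)] fin[OF tu(3)] pos[OF tu(3)] AE_space
    unfolding u_def[symmetric]
  proof eventually_elim
    case (elim \<omega>)
    note Kt = K_sets[OF tu(1) elim(5)] K_space[OF tu(1) elim(5)]
    note Ku = K_sets[OF tu(3) elim(5)] K_space[OF tu(3) elim(5)]
    have [measurable]: "Z u \<in> borel_measurable (K u \<omega>)" "Z t \<in> borel_measurable (K t \<omega>)"
      using Z_G tu Kt Ku measurable_cong_sets by blast+
    \<comment> \<open>Weight first, restrict afterwards: \<open>Z u\<close> is measurable for
      \<open>G u\<close> but possibly not for \<open>G t\<close>.\<close>
    let ?N = "restr_to_subalg (density (K u \<omega>) (\<lambda>\<omega>'. ennreal (Z u \<omega>'))) (G t)"
    let ?N' = "density (K t \<omega>) (\<lambda>\<omega>'. ennreal (Z t \<omega>'))"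
    have sub_K: "subalgebra (K u \<omega>) (G t)" and sub_dens: "subalgebra (density (K u \<omega>) (\<lambda>\<omega>'. ennreal (Z u \<omega>'))) (G t)"
      using subG' Ku space_G by (auto simp: subalgebra_def)
    have N: "sets ?N = sets (G t)" "space ?N = space M"
      by (simp_all add: sets_restr_to_subalg[OF sub_dens] space_restr_to_subalg Ku)
    have N': "sets ?N' = sets (G t)" "space ?N' = space M" by (simp_all add: Kt)
    have em_N: "emeasure ?N A = d u A \<omega>" if "A \<in> sets (G t)" for A
    proof -
      have "A \<in> sets (K u \<omega>)" using that sub_K by (auto simp: subalgebra_def)
      then show ?thesis
        by (simp add: emeasure_restr_to_subalg[OF sub_dens that] emeasure_density d_def)
    qed
    have em_N': "emeasure ?N' A = d t A \<omega>" if "A \<in> sets (G t)" for A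
      using that by (simp add: emeasure_density d_def Kt)
    have top: "space M \<in> sets (G t)" using sets.top[of "G t"] by (simp add: space_G)
    have dom: "d u A \<omega> \<le> d t A \<omega>" if A: "A \<in> sets (G t)" for A
    proof -
      have "emeasure ?N A \<le> emeasure ?N' A"
      proof (rule measure_le_of_generating_algebra)
        show "finite_measure ?N" by (rule finite_measureI) (use elim em_N[OF top] N in simp)
        show "finite_measure ?N'" by (rule finite_measureI) (use elim em_N'[OF top] N' in simp)
        show "emeasure ?N A \<le> emeasure ?N' A" if "A \<in> B" for A
          using elim(1) that em_N em_N' B(3) by auto
      qed (use A B N N' in auto)
      then show ?thesis using em_N[OF A] em_N'[OF A] by simp
    qed
    show ?case
      unfolding absolutely_continuous_def
    proof
      fix A assume A: "A \<in> null_sets (K t \<omega>)"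
      then have A_G: "A \<in> sets (G t)" using Kt by auto
      then have A_u[measurable]: "A \<in> sets (K u \<omega>)" using sub_K by (auto simp: subalgebra_def)
      have "d t A \<omega> = 0"
        unfolding d_def using nn_integral_null_set[OF A] by simp
      then have "d u A \<omega> = 0" using dom[OF A_G] by simp
      \<comment> \<open>A vanishing integral makes the integrand vanish almost everywhere; its
        factor \<open>Z u\<close> is positive there, so the indicator of A must vanish.\<close>
      then have "AE \<omega>' in K u \<omega>. ennreal (Z u \<omega>') * indicator A \<omega>' = 0"
        unfolding d_def by (subst (asm) nn_integral_0_iff_AE) auto
      with elim(4) have "AE \<omega>' in K u \<omega>. \<omega>' \<notin> A"
        by eventually_elim (auto simp: indicator_def split: if_splits)
      then have "A \<in> null_sets (K u \<omega>)" by (simp add: AE_iff_null_sets[symmetric])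
      with A_G show "A \<in> null_sets (restr_to_subalg (K u \<omega>) (G t))"
        by (simp add: null_sets_restr_to_subalg[OF sub_K])
    qed
  qed
qed

end
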